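(* Assume that the quadratic Schrödinger equation $$i\partial_t u=-\partial_x^2u+\mu u^2\quad\text{on }(0,T)\times\mathbb T,\qquad u(0)=u_0,$$ admits an exact solution $u\in C([0,T];H^r(\mathbb T))$ with $r>1/2$. Let $U_n^k$ denote the parareal approximation at the $k$-th iteration and the $n$-th coarse grid point $T_n=n\tau$ obtained with the exact fine propagator $\mathcal F_\tau$ and the coarse propagator $$\mathcal G_\tau(v)=(1-2i\mu\tau\hat v_0)\,e^{i\tau\partial_x^2}v+i\mu\tau(\hat v_0)^2+\frac{\mu}{2}\big(e^{i\tau\partial_x^2}\partial_x^{-1}v\big)^2-\frac{\mu}{2}e^{i\tau\partial_x^2}\big(\partial_x^{-1}v\big)^2,$$ and let $U_n=u(T_n)$. Then there exist constants $\tau_0$, $C_1$ and $C_2$, independent of $n$ and $k$, such that, for any $0<\tau\le\tau_0$, $$\max_{1\le n\le N_c}\|U_n^k-U_n\|_{H^r}\le C_1(C_2\tau)^k .$$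
   Context: $\mathbb T=(0,2\pi)$ with periodic boundary conditions; $\mu$ is the constant coefficient of the nonlinearity; $\tau$ is the coarse time-step size and $N_c=T/\tau\in\mathbb N$ is the number of coarse intervals. Fourier series: $f(x)=\sum_{k\in\mathbb Z}\hat f_k e^{ikx}$, so $\hat f_0$ is the mean of $f$. The regularized inverse derivative is $\partial_x^{-1}f(x)=\sum_{k\ne0}(ik)^{-1}\hat f_k e^{ikx}$ (zero mode set to $0$). Exact fine propagator: $\mathcal F_\tau(v)$ is the value at time $\tau$ of the exact solution of the equation with initial value $v$ at time $0$. Parareal algorithm: $U_0^k=u_0$ for all $k$, and $$U_{n+1}^0=\mathcal G_\tau(U_n^0),\qquad U_{n+1}^{k+1}=\mathcal G_\tau(U_n^{k+1})+(\mathcal F_\tau-\mathcal G_\tau)(U_n^k),$$ for $n=0,\dots,N_c-1$ and $k=0,1,2,\dots$. *)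

theory Defs
  imports "HOL-Analysis.Analysis"
begin

text \<open>
  A function on the torus is a function \<open>real \<Rightarrow> complex\<close> of which only the almost everywhere
  class on \<open>(0, 2 pi)\<close> matters; periodicity enters through the Fourier coefficients.
\<close>

abbreviation torus :: "real measure" where
  "torus \<equiv> lebesgue_on {0<..<2 * pi}"

definition fourier_coeff :: "(real \<Rightarrow> complex) \<Rightarrow> int \<Rightarrow> complex" where
  "fourier_coeff f k = (LINT x|torus. f x * cis (- (of_int k * x))) / (2 * pi)"

definition sobolev :: "real \<Rightarrow> (real \<Rightarrow> complex) set" where
  "sobolev r = {f. f \<in> borel_measurable torus \<and>
     integrable torus (\<lambda>x. (cmod (f x))\<^sup>2) \<and>
     (\<lambda>k::int. (1 + (of_int k)\<^sup>2) powr r * (cmod (fourier_coeff f k))\<^sup>2) summable_on UNIV}"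

text \<open>Only meaningful on \<open>sobolev r\<close>: a divergent sum has value \<open>0\<close>.\<close>

definition sobolev_norm :: "real \<Rightarrow> (real \<Rightarrow> complex) \<Rightarrow> real" where
  "sobolev_norm r f =
     sqrt (\<Sum>\<^sub>\<infinity>k::int. (1 + (of_int k)\<^sup>2) powr r * (cmod (fourier_coeff f k))\<^sup>2)"

text \<open>
  The series is summed pointwise. It converges absolutely in all uses below, since functions in
  \<open>sobolev r\<close> with \<open>r > 1/2\<close> have absolutely summable Fourier coefficients.
\<close>

definition fourier_multiplier :: "(int \<Rightarrow> complex) \<Rightarrow> (real \<Rightarrow> complex) \<Rightarrow> real \<Rightarrow> complex" where
  "fourier_multiplier m f x = (\<Sum>\<^sub>\<infinity>k::int. m k * fourier_coeff f k * cis (of_int k * x))"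

definition free_flow :: "real \<Rightarrow> (real \<Rightarrow> complex) \<Rightarrow> real \<Rightarrow> complex" where
  "free_flow t = fourier_multiplier (\<lambda>k. cis (- (t * (of_int k)\<^sup>2)))"

definition inv_deriv :: "(real \<Rightarrow> complex) \<Rightarrow> real \<Rightarrow> complex" where
  "inv_deriv = fourier_multiplier (\<lambda>k. if k = 0 then 0 else inverse (\<i> * of_int k))"

text \<open>
  Solutions in \<open>C([0,T]; H^r)\<close> of \<open>i u_t = - u_xx + mu u^2\<close> with \<open>u(0) = v\<close>. For small \<open>r\<close> the
  second derivative is not a function, so the equation is read as an identity of periodic
  distributions at each time \<open>t\<close> in \<open>(0,T)\<close>, that is, as equality of all Fourier coefficients,
  where \<open>- u_xx\<close> has coefficients \<open>k^2 * fourier_coeff u k\<close>.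
\<close>

definition nls_solution ::
  "real \<Rightarrow> complex \<Rightarrow> real \<Rightarrow> (real \<Rightarrow> complex) \<Rightarrow> (real \<Rightarrow> real \<Rightarrow> complex) \<Rightarrow> bool" where
  "nls_solution r \<mu> T v u \<longleftrightarrow>
     (\<forall>t\<in>{0..T}. u t \<in> sobolev r) \<and>
     (\<forall>t\<in>{0..T}. ((\<lambda>s. sobolev_norm r (\<lambda>x. u s x - u t x)) \<longlongrightarrow> 0) (at t within {0..T})) \<and>
     (AE x in torus. u 0 x = v x) \<and>
     (\<forall>t\<in>{0<..<T}. \<forall>k. \<exists>D.
        ((\<lambda>s. fourier_coeff (u s) k) has_vector_derivative D) (at t) \<and>
        \<i> * D = (of_int k)\<^sup>2 * fourier_coeff (u t) k + \<mu> * fourier_coeff (\<lambda>x. (u t x)\<^sup>2) k)"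

text \<open>
  The value is determined up to null sets when a solution on \<open>[0,\<tau>]\<close> exists, and is
  unspecified otherwise.
\<close>

definition fine_propagator ::
  "real \<Rightarrow> complex \<Rightarrow> real \<Rightarrow> (real \<Rightarrow> complex) \<Rightarrow> real \<Rightarrow> complex" where
  "fine_propagator r \<mu> \<tau> v = (SOME w. \<exists>u. nls_solution r \<mu> \<tau> v u \<and> w = u \<tau>)"

definition coarse_propagator ::
  "complex \<Rightarrow> real \<Rightarrow> (real \<Rightarrow> complex) \<Rightarrow> real \<Rightarrow> complex" where
  "coarse_propagator \<mu> \<tau> v x =
     (1 - 2 * \<i> * \<mu> * \<tau> * fourier_coeff v 0) * free_flow \<tau> v x
     + \<i> * \<mu> * \<tau> * (fourier_coeff v 0)\<^sup>2
     + \<mu> / 2 * (free_flow \<tau> (inv_deriv v) x)\<^sup>2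
     - \<mu> / 2 * free_flow \<tau> (\<lambda>y. (inv_deriv v y)\<^sup>2) x"

text \<open>\<open>parareal F G u0 k n\<close> is the \<open>k\<close>-th iterate at the \<open>n\<close>-th coarse grid point.\<close>

fun parareal ::
  "((real \<Rightarrow> complex) \<Rightarrow> real \<Rightarrow> complex) \<Rightarrow> ((real \<Rightarrow> complex) \<Rightarrow> real \<Rightarrow> complex) \<Rightarrow>
   (real \<Rightarrow> complex) \<Rightarrow> nat \<Rightarrow> nat \<Rightarrow> real \<Rightarrow> complex" where
  "parareal F G u0 k 0 = u0"
| "parareal F G u0 0 (Suc n) = G (parareal F G u0 0 n)"
| "parareal F G u0 (Suc k) (Suc n) =
     (\<lambda>x. G (parareal F G u0 (Suc k) n) x
        + (F (parareal F G u0 k n) x - G (parareal F G u0 k n) x))"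

end

theory Submission
  imports Defs
begin

text \<open>
  Write a function of \<open>H^r\<close> through its Fourier coefficients weighted by \<open>(1 + k^2)^(r/2)\<close>, an
  element of \<open>l^2\<close>. For \<open>r > 1/2\<close> the Cauchy-Schwarz inequality makes the weighted convolution a
  bounded bilinear map, so that in the interaction picture \<open>y(t) = exp(- i t d_x^2) u(t)\<close> the
  equation becomes an ordinary differential equation \<open>y' = N t y y\<close> with \<open>N t\<close> bounded
  bilinear, uniformly in \<open>t\<close>. Because \<open>(k + l)^2 - k^2 - l^2 = 2 k l\<close>, the
  phases integrate in closed form, and the coarse propagator is exactly the first Picard
  iterate \<open>x + \<integral>\<^sub>0\<^sup>\<tau> N s x x ds\<close>. Its defect with respect to the exact flow is of order \<open>\<tau>^2\<close> and so
  is the Lipschitz constant of the defect. Hence the errors satisfy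
  \<open>e (k+1) (n+1) \<le> (1 + a \<tau>) e (k+1) n + b \<tau>^2 e k n\<close>, and each iteration gains a factor
  \<open>C \<tau>\<close>. Since the errors stay below \<open>1\<close> for small \<open>\<tau>\<close>, all iterates stay in one ball, where
  these constants are uniform.
\<close>

section \<open>The Hilbert sequence space\<close>

text \<open>The statement constrains only almost everywhere classes and single Fourier coefficients,
  and the fine propagator is an unspecified choice unless a solution exists. So local well-posedness
  has to be proved for every iterate, not only for the given solution, and functions have to be
  identified with sequences, which rests on the uniqueness of Fourier coefficients. A sequence space
  that is a Banach space as a type makes integration of curves and the contraction principle
  available, and there the free flow is an isometry; conjugating by it removes the unbounded
  operator, so that the defect of order \<open>\<tau>^2\<close> costs no derivatives. The price is
  that the conjugated nonlinearity depends on time only strongly continuously. Continuity and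
  operator identities are therefore checked on single modes and extended by density and uniform
  bounds. The Lipschitz constants hold on a ball only; the argument that no iterate leaves it is
  part of the same induction that produces the powers of \<open>\<tau>\<close>.\<close>

typedef 'a ell2 = "{x::'a \<Rightarrow> complex. (\<lambda>k. (cmod (x k))\<^sup>2) summable_on UNIV}"
  morphisms coord Abs_ell2
  by (rule exI[of _ "\<lambda>_. 0"]) simp

text \<open>Membership in the type is restated through bounds on finite sections that are uniform in
  the section, so that Minkowski's inequality for \<open>L2_set\<close> carries over to infinite
  sequences.\<close>

lemma square_summable_iff:
  fixes x :: "'a \<Rightarrow> complex"
  shows "(\<lambda>k. (cmod (x k))\<^sup>2) summable_on UNIV \<longleftrightarrow>
    (\<exists>c. \<forall>F. finite F \<longrightarrow> L2_set (\<lambda>k. cmod (x k)) F \<le> c)"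
proof
  assume s: "(\<lambda>k. (cmod (x k))\<^sup>2) summable_on UNIV"
  have "L2_set (\<lambda>k. cmod (x k)) F \<le> sqrt (\<Sum>\<^sub>\<infinity>k. (cmod (x k))\<^sup>2)" if "finite F" for F
    unfolding L2_set_def by (intro real_sqrt_le_mono finite_sum_le_infsum s that) auto
  then show "\<exists>c. \<forall>F. finite F \<longrightarrow> L2_set (\<lambda>k. cmod (x k)) F \<le> c" by blast
next
  assume "\<exists>c. \<forall>F. finite F \<longrightarrow> L2_set (\<lambda>k. cmod (x k)) F \<le> c"
  then obtain c where c: "\<And>F. finite F \<Longrightarrow> L2_set (\<lambda>k. cmod (x k)) F \<le> c" by blast
  have "(\<Sum>k\<in>F. (cmod (x k))\<^sup>2) \<le> c\<^sup>2" if "finite F" for F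
    using c[OF that] unfolding L2_set_def by (simp add: sqrt_le_D)
  then show "(\<lambda>k. (cmod (x k))\<^sup>2) summable_on UNIV"
    by (intro nonneg_bdd_above_summable_on) (auto simp: bdd_above_def)
qed

lemma coord_Abs_ell2:
  assumes "\<And>F. finite F \<Longrightarrow> L2_set (\<lambda>k. cmod (x k)) F \<le> c"
  shows "coord (Abs_ell2 x) = x"
  using assms by (intro Abs_ell2_inverse) (auto simp: square_summable_iff)

lemma square_summable_coord: "(\<lambda>k. (cmod (coord x k))\<^sup>2) summable_on UNIV"
  using coord[of x] by simp

lemma ell2_eqI: "(\<And>k. coord x k = coord y k) \<Longrightarrow> x = y"
  by (metis coord_inject ext)

instantiation ell2 :: (type) real_normed_vector
begin

definition "0 = Abs_ell2 (\<lambda>_. 0)"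
definition "x + y = Abs_ell2 (\<lambda>k. coord x k + coord y k)"
definition "x - y = Abs_ell2 (\<lambda>k. coord x k - coord y k)"
definition "- x = Abs_ell2 (\<lambda>k. - coord x k)"
definition "c *\<^sub>R x = Abs_ell2 (\<lambda>k. of_real c * coord x k)"
definition norm_ell2_def: "norm x = sqrt (\<Sum>\<^sub>\<infinity>k. (cmod (coord x k))\<^sup>2)"
definition "dist x y = norm (x - y)" for x y :: "'a ell2"
definition "uniformity = (INF e\<in>{0<..}. principal {(x, y :: 'a ell2). dist x y < e})"
definition "open U \<longleftrightarrow> (\<forall>x\<in>U. \<forall>\<^sub>F (x', y) in uniformity. x' = x \<longrightarrow> y \<in> U)" for U :: "'a ell2 set"
definition "sgn x = inverse (norm x) *\<^sub>R x" for x :: "'a ell2"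

lemma L2_set_coord_le_norm: "finite F \<Longrightarrow> L2_set (\<lambda>k. cmod (coord x k)) F \<le> norm x"
  unfolding L2_set_def norm_ell2_def
  by (intro real_sqrt_le_mono finite_sum_le_infsum square_summable_coord) auto

lemma norm_ell2_le:
  assumes "\<And>F. finite F \<Longrightarrow> L2_set (\<lambda>k. cmod (coord x k)) F \<le> c"
  shows "norm x \<le> c"
proof -
  have c: "0 \<le> c" using assms[of "{}"] by simp
  have "(\<Sum>k\<in>F. (cmod (coord x k))\<^sup>2) \<le> c\<^sup>2" if "finite F" for F
    using assms[OF that] unfolding L2_set_def by (simp add: sqrt_le_D)
  then have "(\<Sum>\<^sub>\<infinity>k. (cmod (coord x k))\<^sup>2) \<le> c\<^sup>2"
    by (intro infsum_le_finite_sums square_summable_coord) auto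
  then show ?thesis unfolding norm_ell2_def using c by (simp add: real_le_lsqrt infsum_nonneg)
qed

lemma L2_set_coord_add_le:
  assumes "finite F"
  shows "L2_set (\<lambda>k. cmod (coord x k + coord y k)) F \<le> norm x + norm y"
proof -
  have "L2_set (\<lambda>k. cmod (coord x k + coord y k)) F \<le> L2_set (\<lambda>k. cmod (coord x k) + cmod (coord y k)) F"
    by (intro L2_set_mono norm_triangle_ineq) auto
  also have "\<dots> \<le> L2_set (\<lambda>k. cmod (coord x k)) F + L2_set (\<lambda>k. cmod (coord y k)) F"
    by (rule L2_set_triangle_ineq)
  also have "\<dots> \<le> norm x + norm y" using assms by (intro add_mono L2_set_coord_le_norm)
  finally show ?thesis .
qed

lemma L2_set_coord_scale_le:
  assumes "finite F"
  shows "L2_set (\<lambda>k. cmod (of_real c * coord x k)) F \<le> \<bar>c\<bar> * norm x"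
  using L2_set_coord_le_norm[OF assms, of x]
  by (simp add: norm_mult L2_set_right_distrib[symmetric] mult_left_mono)

lemma coord_zero: "coord 0 k = 0"
  unfolding zero_ell2_def by (subst coord_Abs_ell2[of _ 0]) (auto simp: L2_set_def)

lemma coord_add: "coord (x + y) k = coord x k + coord y k"
  unfolding plus_ell2_def by (subst coord_Abs_ell2[OF L2_set_coord_add_le]) auto

lemma coord_scale: "coord (c *\<^sub>R x) k = of_real c * coord x k"
  unfolding scaleR_ell2_def by (subst coord_Abs_ell2[OF L2_set_coord_scale_le]) auto

lemma coord_uminus: "coord (- x) k = - coord x k"
  unfolding uminus_ell2_def
  by (subst coord_Abs_ell2[of _ "norm x"]) (auto simp: L2_set_coord_le_norm)

lemma coord_minus: "coord (x - y) k = coord x k - coord y k"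
proof -
  have "L2_set (\<lambda>k. cmod (coord x k - coord y k)) F \<le> norm x + norm (- y)" if "finite F" for F
    using L2_set_coord_add_le[OF that, of x "-y"] by (simp add: coord_uminus)
  then show ?thesis unfolding minus_ell2_def by (subst coord_Abs_ell2) auto
qed

instance
proof
  fix x y z :: "'a ell2" and a b :: real
  show "dist x y = norm (x - y)" by (rule dist_ell2_def)
  show "sgn x = inverse (norm x) *\<^sub>R x" by (simp add: sgn_ell2_def)
  show "uniformity = (INF e\<in>{0<..}. principal {(x, y::'a ell2). dist x y < e})"
    by (rule uniformity_ell2_def)
  show "open U = (\<forall>x\<in>U. \<forall>\<^sub>F (x', y) in uniformity. x' = x \<longrightarrow> y \<in> U)" for U :: "'a ell2 set"
    by (rule open_ell2_def)
  show "x + y + z = x + (y + z)"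
    by (rule ell2_eqI) (simp add: coord_zero coord_add coord_scale coord_uminus coord_minus algebra_simps)
  show "x + y = y + x"
    by (rule ell2_eqI) (simp add: coord_zero coord_add coord_scale coord_uminus coord_minus algebra_simps)
  show "0 + x = x"
    by (rule ell2_eqI) (simp add: coord_zero coord_add coord_scale coord_uminus coord_minus algebra_simps)
  show "- x + x = 0"
    by (rule ell2_eqI) (simp add: coord_zero coord_add coord_scale coord_uminus coord_minus algebra_simps)
  show "x - y = x + - y"
    by (rule ell2_eqI) (simp add: coord_zero coord_add coord_scale coord_uminus coord_minus algebra_simps)
  show "a *\<^sub>R (x + y) = a *\<^sub>R x + a *\<^sub>R y"
    by (rule ell2_eqI) (simp add: coord_zero coord_add coord_scale coord_uminus coord_minus algebra_simps)
  show "(a + b) *\<^sub>R x = a *\<^sub>R x + b *\<^sub>R x"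
    by (rule ell2_eqI) (simp add: coord_zero coord_add coord_scale coord_uminus coord_minus algebra_simps)
  show "a *\<^sub>R b *\<^sub>R x = (a * b) *\<^sub>R x"
    by (rule ell2_eqI) (simp add: coord_zero coord_add coord_scale coord_uminus coord_minus algebra_simps)
  show "1 *\<^sub>R x = x"
    by (rule ell2_eqI) (simp add: coord_zero coord_add coord_scale coord_uminus coord_minus algebra_simps)
  show "norm x = 0 \<longleftrightarrow> x = 0"
  proof
    assume n: "norm x = 0"
    have "cmod (coord x k) \<le> 0" for k using L2_set_coord_le_norm[of "{k}" x] n by simp
    then show "x = 0" by (intro ell2_eqI) (simp add: coord_zero)
  next
    assume "x = 0"
    then show "norm x = 0" by (simp add: norm_ell2_def coord_zero)
  qed
  show "norm (x + y) \<le> norm x + norm y" by (rule norm_ell2_le) (simp add: coord_add L2_set_coord_add_le)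
  \<comment> \<open>One inequality suffices: applied to \<open>inverse a\<close> and
    \<open>a *\<^sub>R x\<close> it gives the converse.\<close>
  have le: "norm (a *\<^sub>R x) \<le> \<bar>a\<bar> * norm x" for a and x :: "'a ell2"
    by (rule norm_ell2_le) (simp add: coord_scale L2_set_coord_scale_le)
  show "norm (a *\<^sub>R x) = \<bar>a\<bar> * norm x"
  proof (cases "a = 0")
    case True
    then have "norm (a *\<^sub>R x) \<le> 0" using le[of a x] by simp
    moreover have "norm (a *\<^sub>R x) \<ge> 0" by (simp add: norm_ell2_def infsum_nonneg)
    ultimately show ?thesis using True by simp
  next
    case False
    have "inverse a *\<^sub>R a *\<^sub>R x = x" using False by (intro ell2_eqI) (simp add: coord_scale)
    then have "norm x \<le> \<bar>inverse a\<bar> * norm (a *\<^sub>R x)" using le[of "inverse a" "a *\<^sub>R x"] by simp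
    then have "\<bar>a\<bar> * norm x \<le> norm (a *\<^sub>R x)" using False by (simp add: field_simps)
    with le[of a x] show ?thesis by simp
  qed
qed

end

lemma coord_simps [simp]:
  "coord 0 k = 0"
  "coord (x + y) k = coord x k + coord y k"
  "coord (x - y) k = coord x k - coord y k"
  "coord (- x) k = - coord x k"
  "coord (c *\<^sub>R x) k = of_real c * coord x k"
  by (fact coord_zero coord_add coord_minus coord_uminus coord_scale)+

lemma norm_ell2_power2: "(norm x)\<^sup>2 = (\<Sum>\<^sub>\<infinity>k. (cmod (coord x k))\<^sup>2)"
  unfolding norm_ell2_def by (simp add: infsum_nonneg)

lemma sum_coord_le_norm:
  assumes "finite F"
  shows "(\<Sum>k\<in>F. (cmod (coord x k))\<^sup>2) \<le> (norm x)\<^sup>2"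
  unfolding norm_ell2_power2 by (intro finite_sum_le_infsum square_summable_coord assms) auto

lemma norm_coord_le: "cmod (coord x k) \<le> norm x"
  using L2_set_coord_le_norm[of "{k}" x] by simp

lemma bounded_linear_coord: "bounded_linear (\<lambda>x. coord x k)"
  by (rule bounded_linear_intro[of _ 1]) (auto simp: norm_coord_le scaleR_conv_of_real)

lemmas continuous_on_coord [continuous_intros] = bounded_linear.continuous_on[OF bounded_linear_coord]

instance ell2 :: (type) banach
proof
  fix X :: "nat \<Rightarrow> 'a ell2"
  assume X: "Cauchy X"
  have "convergent (\<lambda>n. coord (X n) k)" for k
    using bounded_linear.Cauchy[OF bounded_linear_coord X] by (rule Cauchy_convergent)
  then obtain x where x: "\<And>k. (\<lambda>n. coord (X n) k) \<longlonglongrightarrow> x k"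
    unfolding convergent_def by metis
  \<comment> \<open>A finite section commutes with the coordinatewise limit, as in Fatou's lemma.
    The resulting bound is uniform in \<open>F\<close>, which places the limit sequence in the space
    and gives convergence in norm.\<close>
  have le: "L2_set (\<lambda>k. cmod (coord (X m) k - x k)) F \<le> e"
    if "finite F" and N: "\<forall>n\<ge>N. norm (X m - X n) < e" for F e N m
  proof (rule tendsto_upperbound)
    show "(\<lambda>n. L2_set (\<lambda>k. cmod (coord (X m - X n) k)) F)
        \<longlonglongrightarrow> L2_set (\<lambda>k. cmod (coord (X m) k - x k)) F"
      unfolding L2_set_def coord_simps by (intro tendsto_intros x)
    show "\<forall>\<^sub>F n in sequentially. L2_set (\<lambda>k. cmod (coord (X m - X n) k)) F \<le> e"
      unfolding eventually_sequentially
    proof (intro exI allI impI)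
      fix n assume "N \<le> n"
      then show "L2_set (\<lambda>k. cmod (coord (X m - X n) k)) F \<le> e"
        using N L2_set_coord_le_norm[OF that(1), of "X m - X n"] by fastforce
    qed
  qed simp
  obtain N where "\<forall>m\<ge>N. \<forall>n\<ge>N. norm (X m - X n) < 1"
    using X unfolding Cauchy_iff by (meson zero_less_one)
  then have N: "\<forall>n\<ge>N. norm (X N - X n) < 1" by blast
  have "L2_set (\<lambda>k. cmod (x k)) F \<le> norm (X N) + 1" if F: "finite F" for F
  proof -
    have "L2_set (\<lambda>k. cmod (x k)) F
        \<le> L2_set (\<lambda>k. cmod (coord (X N) k) + cmod (coord (X N) k - x k)) F"
      by (intro L2_set_mono) (auto intro: norm_triangle_sub simp: norm_minus_commute)
    also have "\<dots> \<le> L2_set (\<lambda>k. cmod (coord (X N) k)) F + L2_set (\<lambda>k. cmod (coord (X N) k - x k)) F"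
      by (rule L2_set_triangle_ineq)
    also have "\<dots> \<le> norm (X N) + 1"
      by (intro add_mono L2_set_coord_le_norm le[OF F N] F)
    finally show ?thesis .
  qed
  then have c: "coord (Abs_ell2 x) = x" by (rule coord_Abs_ell2)
  have "X \<longlonglongrightarrow> Abs_ell2 x"
  proof (rule metric_LIMSEQ_I)
    fix e :: real assume "e > 0"
    then obtain M where M: "\<forall>m\<ge>M. \<forall>n\<ge>M. norm (X m - X n) < e / 2"
      using X unfolding Cauchy_iff by (meson half_gt_zero)
    have "dist (X n) (Abs_ell2 x) < e" if "n \<ge> M" for n
    proof -
      have "norm (X n - Abs_ell2 x) \<le> e / 2"
      proof (rule norm_ell2_le)
        fix F :: "'a set" assume "finite F"
        then show "L2_set (\<lambda>k. cmod (coord (X n - Abs_ell2 x) k)) F \<le> e / 2"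
          using le[of F M n "e / 2"] M that by (simp add: c)
      qed
      then show ?thesis using \<open>e > 0\<close> by (simp add: dist_norm)
    qed
    then show "\<exists>M. \<forall>n\<ge>M. dist (X n) (Abs_ell2 x) < e" by blast
  qed
  then show "convergent X" by (rule convergentI)
qed

section \<open>Single modes, density and diagonal operators\<close>

definition single :: "'a \<Rightarrow> complex \<Rightarrow> 'a ell2" where
  "single k c = Abs_ell2 (\<lambda>j. if j = k then c else 0)"

lemma coord_single [simp]: "coord (single k c) j = (if j = k then c else 0)"
proof -
  have "L2_set (\<lambda>j. cmod (if j = k then c else 0)) F \<le> cmod c" if "finite F" for F
  proof -
    have "(\<Sum>j\<in>F. (cmod (if j = k then c else 0))\<^sup>2) = (\<Sum>j\<in>F. if j = k then (cmod c)\<^sup>2 else 0)"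
      by (intro sum.cong) auto
    then show ?thesis using that unfolding L2_set_def by (auto simp: sum.delta)
  qed
  then show ?thesis unfolding single_def by (subst coord_Abs_ell2) auto
qed

lemma coord_sum [simp]: "coord (\<Sum>i\<in>A. f i) k = (\<Sum>i\<in>A. coord (f i) k)"
  by (induction A rule: infinite_finite_induct) auto

text \<open>Pythagoras: removing the coordinates in \<open>F\<close> leaves a vector of squared norm
  at most \<open>(norm x)\<^sup>2\<close> minus the mass on \<open>F\<close>, and this mass tends to
  the whole.\<close>

lemma has_sum_single: "((\<lambda>k. single k (coord x k)) has_sum x) UNIV"
proof -
  let ?s = "\<lambda>F. \<Sum>k\<in>F. single k (coord x k)"
  let ?q = "\<lambda>F. \<Sum>k\<in>F. (cmod (coord x k))\<^sup>2"
  have c: "coord (x - ?s F) k = (if k \<in> F then 0 else coord x k)" if "finite F" for F k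
    using that by (simp add: sum.delta)
  have le: "norm (x - ?s F) \<le> sqrt ((norm x)\<^sup>2 - ?q F)" if F: "finite F" for F
  proof (rule norm_ell2_le)
    fix G :: "'a set" assume G: "finite G"
    have "(\<Sum>k\<in>G. (cmod (coord (x - ?s F) k))\<^sup>2) = ?q (G - F)"
      unfolding c[OF F] using G by (intro sum.mono_neutral_cong_right) auto
    also have "\<dots> = ?q (G - F \<union> F) - ?q F"
      using F G by (subst sum.union_disjoint) auto
    also have "\<dots> \<le> (norm x)\<^sup>2 - ?q F"
      using sum_coord_le_norm[of "G - F \<union> F" x] F G by (simp del: Un_Diff_cancel2)
    finally show "L2_set (\<lambda>k. cmod (coord (x - ?s F) k)) G \<le> sqrt ((norm x)\<^sup>2 - ?q F)"
      unfolding L2_set_def by (rule real_sqrt_le_mono)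
  qed
  have "(?q \<longlongrightarrow> (norm x)\<^sup>2) (finite_subsets_at_top UNIV)"
    using has_sum_infsum[OF square_summable_coord[of x]] unfolding has_sum_def norm_ell2_power2 .
  then have "((\<lambda>F. sqrt ((norm x)\<^sup>2 - ?q F)) \<longlongrightarrow> sqrt ((norm x)\<^sup>2 - (norm x)\<^sup>2)) (finite_subsets_at_top UNIV)"
    by (intro tendsto_intros)
  then have lim: "((\<lambda>F. sqrt ((norm x)\<^sup>2 - ?q F)) \<longlongrightarrow> 0) (finite_subsets_at_top UNIV)"
    by simp
  have "((\<lambda>F. norm (x - ?s F)) \<longlongrightarrow> 0) (finite_subsets_at_top UNIV)"
  proof (rule tendsto_sandwich[OF _ _ tendsto_const lim])
    show "\<forall>\<^sub>F F in finite_subsets_at_top UNIV. norm (x - ?s F) \<le> sqrt ((norm x)\<^sup>2 - ?q F)"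
      by (rule eventually_finite_subsets_at_top_weakI) (rule le)
  qed simp
  then have "((\<lambda>F. norm (?s F - x)) \<longlongrightarrow> 0) (finite_subsets_at_top UNIV)"
    by (simp add: norm_minus_commute)
  then show ?thesis unfolding has_sum_def
    using LIM_zero_iff tendsto_norm_zero_iff by blast
qed

text \<open>Density of finite combinations of modes. All complex amplitudes \<open>c\<close> have to
  be tested, because \<open>bounded_linear\<close> means linear over the reals only. This reduces
  the convolution theorem and the closed form of the Duhamel integral to computations with one or
  two frequencies.\<close>

lemma bounded_linear_eq_on_single:
  assumes "bounded_linear f" "bounded_linear g"
    and "\<And>k c. f (single k c) = g (single k c)"
  shows "f x = g x"
proof (rule has_sum_unique)
  show "((\<lambda>k. f (single k (coord x k))) has_sum f x) UNIV"
    by (rule has_sum_bounded_linear[OF assms(1) has_sum_single])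
  show "((\<lambda>k. f (single k (coord x k))) has_sum g x) UNIV"
    unfolding assms(3) by (rule has_sum_bounded_linear[OF assms(2) has_sum_single])
qed

lemma separately_linear_eq_on_single:
  assumes f: "\<And>x. bounded_linear (f x)" "\<And>y. bounded_linear (\<lambda>x. f x y)"
    and g: "\<And>x. bounded_linear (g x)" "\<And>y. bounded_linear (\<lambda>x. g x y)"
    and eq: "\<And>k l c d. f (single k c) (single l d) = g (single k c) (single l d)"
  shows "f x y = g x y"
proof (rule bounded_linear_eq_on_single[where f = "\<lambda>x. f x y" and g = "\<lambda>x. g x y", OF f(2) g(2)])
  show "f (single k c) y = g (single k c) y" for k c
    by (rule bounded_linear_eq_on_single[where f = "f (single k c)" and g = "g (single k c)",
          OF f(1) g(1) eq])
qed

definition diag :: "('a \<Rightarrow> complex) \<Rightarrow> 'a ell2 \<Rightarrow> 'a ell2" where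
  "diag m x = Abs_ell2 (\<lambda>k. m k * coord x k)"

context
  fixes m :: "'a \<Rightarrow> complex" and M :: real
  assumes m: "\<And>k. cmod (m k) \<le> M"
begin

lemma L2_set_diag_le:
  assumes "finite F"
  shows "L2_set (\<lambda>k. cmod (m k * coord x k)) F \<le> M * norm x"
proof -
  have "0 \<le> M" using m[of undefined] norm_ge_zero order_trans by blast
  have "L2_set (\<lambda>k. cmod (m k * coord x k)) F \<le> L2_set (\<lambda>k. M * cmod (coord x k)) F"
    by (intro L2_set_mono) (auto simp: norm_mult intro: mult_right_mono m)
  also have "\<dots> = M * L2_set (\<lambda>k. cmod (coord x k)) F"
    using \<open>0 \<le> M\<close> by (rule L2_set_right_distrib[symmetric])
  also have "\<dots> \<le> M * norm x" by (intro mult_left_mono L2_set_coord_le_norm assms \<open>0 \<le> M\<close>)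
  finally show ?thesis .
qed

lemma coord_diag: "coord (diag m x) k = m k * coord x k"
  unfolding diag_def by (subst coord_Abs_ell2[OF L2_set_diag_le]) auto

lemma norm_diag_le: "norm (diag m x) \<le> M * norm x"
  by (rule norm_ell2_le) (simp add: coord_diag L2_set_diag_le)

lemma bounded_linear_diag: "bounded_linear (diag m)"
  by (rule bounded_linear_intro[of _ M])
    (auto intro!: ell2_eqI simp: coord_diag norm_diag_le distrib_left mult.left_commute mult.commute)

end

section \<open>Ordinary differential equations with quadratic right-hand side\<close>

lemma norm_integral_le:
  fixes f :: "real \<Rightarrow> 'a::banach"
  assumes "0 \<le> t" "continuous_on {0..t} f" "\<And>s. s \<in> {0..t} \<Longrightarrow> norm (f s) \<le> b"
  shows "norm (integral {0..t} f) \<le> b * t"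
  using integral_bound[OF assms] by simp

text \<open>The constants come from maximizing \<open>d t * exp (- 2 * L * t)\<close>.\<close>

lemma gronwall_crude:
  fixes d :: "real \<Rightarrow> real"
  assumes cont: "continuous_on {0..\<tau>} d" and L: "L > 0" and c: "0 \<le> c"
    and nonneg: "\<And>t. t \<in> {0..\<tau>} \<Longrightarrow> 0 \<le> d t"
    and le: "\<And>t. t \<in> {0..\<tau>} \<Longrightarrow> d t \<le> c + L * integral {0..t} d"
    and t: "t \<in> {0..\<tau>}"
  shows "d t \<le> 2 * c * exp (2 * L * t)"
proof -
  define w where "w t = d t * exp (- (2 * L * t))" for t
  have "continuous_on {0..\<tau>} w" unfolding w_def by (intro continuous_intros cont)
  then obtain m where m: "m \<in> {0..\<tau>}" "\<And>s. s \<in> {0..\<tau>} \<Longrightarrow> w s \<le> w m"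
    using continuous_attains_sup[of "{0..\<tau>}" w] t by fastforce
  have d_le: "d s \<le> w m * exp (2 * L * s)" if "s \<in> {0..\<tau>}" for s
  proof -
    have "d s = w s * exp (2 * L * s)" unfolding w_def by (simp add: exp_minus)
    also have "\<dots> \<le> w m * exp (2 * L * s)" by (intro mult_right_mono m that) auto
    finally show ?thesis .
  qed
  have int: "((\<lambda>s. w m * exp (2 * L * s)) has_integral
      w m * exp (2 * L * m) / (2 * L) - w m * exp (2 * L * 0) / (2 * L)) {0..m}"
    using m(1) L
    by (intro fundamental_theorem_of_calculus)
      (auto intro!: derivative_eq_intros simp: has_real_derivative_iff_has_vector_derivative[symmetric])
  have "integral {0..m} d \<le> integral {0..m} (\<lambda>s. w m * exp (2 * L * s))"
    using m(1) by (intro integral_le integrable_continuous_interval d_le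
        continuous_on_subset[OF cont] continuous_intros) auto
  also have "\<dots> \<le> w m * exp (2 * L * m) / (2 * L)"
    using integral_unique[OF int] nonneg[OF m(1)] L by (simp add: w_def)
  finally have "L * integral {0..m} d \<le> w m * exp (2 * L * m) / 2"
    using L by (simp add: field_simps)
  also have "\<dots> = d m / 2" by (simp add: w_def exp_minus)
  finally have "d m \<le> 2 * c" using le[OF m(1)] by simp
  moreover have "w m \<le> d m"
    unfolding w_def using nonneg[OF m(1)] m(1) L by (intro mult_left_le) auto
  ultimately have "w m * exp (2 * L * t) \<le> 2 * c * exp (2 * L * t)" by (intro mult_right_mono) auto
  with d_le[OF t] show ?thesis by linarith
qed

text \<open>Continuity is required along continuous curves only, since in the application
  \<open>N t\<close> contains the free flow, which is strongly but not norm continuous in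
  \<open>t\<close>. Strict positivity of \<open>K\<close> provides the positive rate in
  \<open>gronwall_crude\<close>.\<close>

locale quadratic_ode =
  fixes N :: "real \<Rightarrow> 'a::banach \<Rightarrow> 'a \<Rightarrow> 'a" and K :: real
  assumes bilinear: "bounded_bilinear (N t)"
    and norm_N: "norm (N t x y) \<le> K * norm x * norm y"
    and K_pos: "K > 0"
    and continuous_N: "\<And>A u v. continuous_on A u \<Longrightarrow> continuous_on A v \<Longrightarrow>
      continuous_on A (\<lambda>s. N s (u s) (v s))"
begin

lemmas N_diff_left = bounded_bilinear.diff_left[OF bilinear]
lemmas N_diff_right = bounded_bilinear.diff_right[OF bilinear]

definition mild :: "real \<Rightarrow> 'a \<Rightarrow> (real \<Rightarrow> 'a) \<Rightarrow> bool" where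
  "mild \<tau> x y \<longleftrightarrow> continuous_on {0..\<tau>} y \<and>
     (\<forall>t\<in>{0..\<tau>}. y t = x + integral {0..t} (\<lambda>s. N s (y s) (y s)))"

definition picard1 :: "real \<Rightarrow> 'a \<Rightarrow> 'a" where
  "picard1 \<tau> x = x + integral {0..\<tau>} (\<lambda>s. N s x x)"

lemma norm_N_le:
  assumes "norm x \<le> a" "norm y \<le> b"
  shows "norm (N t x y) \<le> K * a * b"
proof -
  have "K * norm x * norm y \<le> K * a * b"
    using assms K_pos order_trans[OF norm_ge_zero assms(1)] by (intro mult_mono) auto
  with norm_N show ?thesis by (rule order_trans)
qed

lemma norm_N_diff:
  assumes "norm x \<le> M" "norm y \<le> M"
  shows "norm (N t x x - N t y y) \<le> 2 * K * M * norm (x - y)"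
proof -
  have "N t x x - N t y y = N t (x - y) x + N t y (x - y)" by (simp add: N_diff_left N_diff_right)
  also have "norm \<dots> \<le> K * norm (x - y) * M + K * M * norm (x - y)"
    by (intro norm_triangle_mono norm_N_le assms order_refl)
  finally show ?thesis by (simp add: algebra_simps)
qed

lemma continuous_N_subset:
  assumes "continuous_on {0..\<tau>} y" "t \<in> {0..\<tau>}"
  shows "continuous_on {0..t} (\<lambda>s. N s (y s) (y s))"
  using assms by (intro continuous_N) (auto intro: continuous_on_subset)

text \<open>Gronwall with rate \<open>2 * K * M\<close>, the Lipschitz constant of the quadratic
  term on the ball of radius \<open>M\<close>; the crude version doubles both the initial difference
  and the rate.\<close>

lemma mild_diff:
  assumes y: "mild \<tau> x y" and z: "mild \<tau> x' z"
    and M: "\<And>t. t \<in> {0..\<tau>} \<Longrightarrow> norm (y t) \<le> M" "\<And>t. t \<in> {0..\<tau>} \<Longrightarrow> norm (z t) \<le> M" "M > 0"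
    and t: "t \<in> {0..\<tau>}"
  shows "norm (y t - z t) \<le> 2 * norm (x - x') * exp (4 * K * M * t)"
proof -
  have cy: "continuous_on {0..\<tau>} y" and cz: "continuous_on {0..\<tau>} z"
    using y z by (auto simp: mild_def)
  have "norm (y t - z t) \<le> 2 * norm (x - x') * exp (2 * (2 * K * M) * t)"
  proof (rule gronwall_crude[where \<tau> = \<tau> and d = "\<lambda>t. norm (y t - z t)"])
    fix s assume s: "s \<in> {0..\<tau>}"
    have iy: "(\<lambda>r. N r (y r) (y r)) integrable_on {0..s}"
      and iz: "(\<lambda>r. N r (z r) (z r)) integrable_on {0..s}"
      by (intro integrable_continuous_interval continuous_N_subset[OF _ s] cy cz)+
    have "y s - z s = (x - x') + integral {0..s} (\<lambda>r. N r (y r) (y r) - N r (z r) (z r))"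
      using y z s iy iz by (simp add: mild_def Henstock_Kurzweil_Integration.integral_diff)
    also have "norm \<dots> \<le> norm (x - x') + norm (integral {0..s} (\<lambda>r. N r (y r) (y r) - N r (z r) (z r)))"
      by (rule norm_triangle_ineq)
    also have "norm (integral {0..s} (\<lambda>r. N r (y r) (y r) - N r (z r) (z r)))
        \<le> integral {0..s} (\<lambda>r. 2 * K * M * norm (y r - z r))"
      using s by (intro integral_norm_bound_integral integrable_diff iy iz integrable_continuous_interval
          norm_N_diff M continuous_intros continuous_on_subset[OF cy] continuous_on_subset[OF cz]) auto
    finally show "norm (y s - z s) \<le> norm (x - x') + 2 * K * M * integral {0..s} (\<lambda>r. norm (y r - z r))"
      by simp
  qed (use cy cz K_pos M t in \<open>auto intro!: continuous_intros\<close>)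
  then show ?thesis by (simp add: mult.assoc)
qed

lemma mild_unique:
  assumes "mild \<tau> x y" "mild \<tau> x z" "t \<in> {0..\<tau>}"
  shows "y t = z t"
proof -
  have "bounded (y ` {0..\<tau>})" "bounded (z ` {0..\<tau>})"
    using assms unfolding mild_def
    by (blast intro: compact_imp_bounded compact_continuous_image compact_Icc)+
  then obtain a b where "\<forall>t\<in>{0..\<tau>}. norm (y t) \<le> a" "\<forall>t\<in>{0..\<tau>}. norm (z t) \<le> b"
    unfolding bounded_iff by auto
  \<comment> \<open>The common bound comes from compactness of the time interval;
    \<open>max 1\<close> makes it strictly positive, as \<open>mild_diff\<close> asks.\<close>
  then have "norm (y t - z t) \<le> 2 * norm (x - x) * exp (4 * K * max 1 (max a b) * t)"
    by (intro mild_diff[OF assms(1,2) _ _ _ assms(3)]) (auto simp: le_max_iff_disj)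
  then show ?thesis by simp
qed

text \<open>Picard iteration in the ball of radius \<open>R + 1\<close>, which leaves room 1 for the
  integral. Staying in the ball needs \<open>K * (R + 1)\<^sup>2 * \<tau> \<le> 1\<close>, the
  contraction factor 1/2 needs \<open>4 * K * (R + 1) * \<tau> \<le> 1\<close>; as
  \<open>R + 1 \<ge> 1\<close>, one hypothesis covers both. The existence time depends on the data
  only through \<open>R\<close>, hence is uniform over the ball.\<close>

lemma mild_exists:
  assumes x: "norm x \<le> R" and \<tau>: "0 \<le> \<tau>" "4 * K * (R + 1)\<^sup>2 * \<tau> \<le> 1"
  obtains y where "mild \<tau> x y" "\<And>t. t \<in> {0..\<tau>} \<Longrightarrow> norm (y t) \<le> R + 1"
proof -
  have R: "0 \<le> R" using x norm_ge_zero order_trans by blast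
  define S where "S = {f::real \<Rightarrow>\<^sub>C 'a. \<forall>t. norm (f t) \<le> R + 1}"
  define G where "G f t = x + integral {0..t} (\<lambda>s. N s (f s) (f s))" for f :: "real \<Rightarrow>\<^sub>C 'a" and t
  \<comment> \<open>The complete space of bounded continuous functions lives on the whole line, so
    time is clamped to \<open>{0..\<tau>}\<close>; a fixed point is constant on either side of this
    interval.\<close>
  define cl where "cl t = max 0 (min \<tau> t)" for t
  have cl: "cl t \<in> {0..\<tau>}" for t using \<tau> by (auto simp: cl_def)
  have cN: "continuous_on A (\<lambda>s. N s (f s) (f s))" for f :: "real \<Rightarrow>\<^sub>C 'a" and A
    by (intro continuous_N) auto
  have cG: "continuous_on UNIV (\<lambda>t. G f (cl t))" for f
  proof -
    have "continuous_on {0..\<tau>} (G f)" unfolding G_def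
      by (intro continuous_intros indefinite_integral_continuous_1 integrable_continuous_interval cN)
    moreover have "continuous_on UNIV cl" unfolding cl_def by (intro continuous_intros)
    ultimately show ?thesis using cl by (auto intro: continuous_on_compose2)
  qed
  have bG: "norm (G f t) \<le> R + 1" if "f \<in> S" "t \<in> {0..\<tau>}" for f t
  proof -
    have "norm (integral {0..t} (\<lambda>s. N s (f s) (f s))) \<le> K * (R + 1) * (R + 1) * t"
      using that by (intro norm_integral_le cN norm_N_le) (auto simp: S_def)
    also have "\<dots> \<le> K * (R + 1) * (R + 1) * \<tau>"
      using that K_pos R by (intro mult_left_mono) auto
    also have "\<dots> \<le> 1"
    proof -
      have "0 \<le> K * (R + 1) * (R + 1) * \<tau>" using \<tau> K_pos R by auto
      then show ?thesis using \<tau> by (simp add: power2_eq_square mult.assoc)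
    qed
    finally show ?thesis using x unfolding G_def by (intro norm_triangle_le) auto
  qed
  define \<Psi> where "\<Psi> f = Bcontfun (\<lambda>t. G f (cl t))" for f
  have \<Psi>: "apply_bcontfun (\<Psi> f) t = G f (cl t)" if "f \<in> S" for f t
    unfolding \<Psi>_def
    by (subst Bcontfun_inverse) (auto intro!: bcontfun_normI cG bG[OF that] cl)
  have "\<exists>!f\<in>S. \<Psi> f = f"
  proof (rule Banach_fix)
    have "S = PiC UNIV (\<lambda>_. cball 0 (R + 1))" unfolding S_def by (auto simp: mem_PiC_iff Pi_def)
    then have "closed S" by (simp add: closed_PiC)
    then show "complete S" by (simp add: complete_eq_closed)
    have "0 \<in> S" using R by (auto simp: S_def)
    then show "S \<noteq> {}" by auto
    show "\<Psi> ` S \<subseteq> S" by (auto simp: S_def[of] \<Psi>) (use bG cl S_def \<Psi> in fastforce)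
    show "dist (\<Psi> f) (\<Psi> g) \<le> 1 / 2 * dist f g" if "f \<in> S" "g \<in> S" for f g
    proof (rule dist_bound)
      fix t
      have "dist (\<Psi> f t) (\<Psi> g t) = norm (integral {0..cl t} (\<lambda>s. N s (f s) (f s) - N s (g s) (g s)))"
        by (simp add: dist_norm \<Psi> that G_def Henstock_Kurzweil_Integration.integral_diff
            integrable_continuous_interval cN)
      also have "\<dots> \<le> 2 * K * (R + 1) * dist f g * cl t"
      proof (intro norm_integral_le continuous_intros cN)
        fix s
        have "norm (N s (f s) (f s) - N s (g s) (g s)) \<le> 2 * K * (R + 1) * norm (f s - g s)"
          using that by (intro norm_N_diff) (auto simp: S_def)
        also have "\<dots> \<le> 2 * K * (R + 1) * dist f g"
          using K_pos R dist_bounded[of f s g] by (intro mult_left_mono) (auto simp: dist_norm)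
        finally show "norm (N s (f s) (f s) - N s (g s) (g s)) \<le> 2 * K * (R + 1) * dist f g" .
      qed (use cl[of t] in auto)
      also have "\<dots> \<le> 2 * K * (R + 1) * dist f g * \<tau>"
        using cl[of t] K_pos R by (intro mult_left_mono) auto
      also have "\<dots> = (4 * K * (R + 1) * \<tau>) * (1 / 2 * dist f g)" by simp
      also have "\<dots> \<le> 1 * (1 / 2 * dist f g)"
      proof (intro mult_right_mono)
        have "(4 * K * (R + 1) * \<tau>) * 1 \<le> (4 * K * (R + 1) * \<tau>) * (R + 1)"
          using K_pos R \<tau> by (intro mult_left_mono) auto
        also have "\<dots> \<le> 1" using \<tau> by (simp add: power2_eq_square mult_ac)
        finally show "4 * K * (R + 1) * \<tau> \<le> 1" by simp
      qed auto
      finally show "dist (\<Psi> f t) (\<Psi> g t) \<le> 1 / 2 * dist f g" by simp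
    qed
  qed auto
  then obtain f where f: "f \<in> S" "\<Psi> f = f" by blast
  have "f t = G f t" if "t \<in> {0..\<tau>}" for t
    using \<Psi>[OF f(1), of t] f(2) that by (simp add: cl_def)
  then have "mild \<tau> x f" by (simp add: mild_def G_def)
  moreover have "norm (f t) \<le> R + 1" for t using f by (auto simp: S_def)
  ultimately show ?thesis using that by blast
qed

lemma picard1_lipschitz:
  assumes "norm x \<le> R" "norm x' \<le> R" "0 \<le> \<tau>"
  shows "norm (picard1 \<tau> x - picard1 \<tau> x') \<le> (1 + 2 * K * R * \<tau>) * norm (x - x')"
proof -
  have c: "continuous_on A (\<lambda>s. N s z z)" for z A by (intro continuous_N continuous_intros)
  have "picard1 \<tau> x - picard1 \<tau> x' = (x - x') + integral {0..\<tau>} (\<lambda>s. N s x x - N s x' x')"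
    by (simp add: picard1_def Henstock_Kurzweil_Integration.integral_diff integrable_continuous_interval c)
  also have "norm \<dots> \<le> norm (x - x') + 2 * K * R * norm (x - x') * \<tau>"
    using assms by (intro norm_triangle_mono norm_integral_le continuous_intros c norm_N_diff) auto
  finally show ?thesis by (simp add: algebra_simps)
qed

text \<open>This is where the two powers of \<open>\<tau>\<close> come from. With
  \<open>d = y - x\<close> the integrand splits as \<open>N y y - N x x = N d y + N x d\<close>,
  where \<open>d\<close> is of order \<open>s\<close>. In the difference for two initial values each
  of the four terms carries a factor \<open>s\<close> from \<open>d\<close>, \<open>d'\<close> or
  their difference, and a factor \<open>norm (x - x')\<close>; integration supplies the second
  power.\<close>

lemma mild_minus_picard1_lipschitz:
  assumes y: "mild \<tau> x y" and y': "mild \<tau> x' y'" and \<tau>: "0 \<le> \<tau>" "\<tau> \<le> 1"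
    and M: "\<And>t. t \<in> {0..\<tau>} \<Longrightarrow> norm (y t) \<le> M" "\<And>t. t \<in> {0..\<tau>} \<Longrightarrow> norm (y' t) \<le> M" "M > 0"
  shows "norm ((y \<tau> - picard1 \<tau> x) - (y' \<tau> - picard1 \<tau> x'))
    \<le> K\<^sup>2 * M\<^sup>2 * (10 * exp (4 * K * M) + 1) * \<tau>\<^sup>2 * norm (x - x')"
proof -
  define \<delta> where "\<delta> = norm (x - x')"
  define c where "c = 2 * exp (4 * K * M)"
  define Y where "Y s = N s (y s) (y s)" for s
  define Y' where "Y' s = N s (y' s) (y' s)" for s
  define d where "d t = y t - x" for t
  define d' where "d' t = y' t - x'" for t
  have cy: "continuous_on {0..\<tau>} y" and cy': "continuous_on {0..\<tau>} y'"
    using y y' by (auto simp: mild_def)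
  have cY: "continuous_on {0..t} Y" and cY': "continuous_on {0..t} Y'" if "t \<in> {0..\<tau>}" for t
    unfolding Y_def Y'_def by (intro continuous_N_subset[OF _ that] cy cy')+
  have d: "d t = integral {0..t} Y" "d' t = integral {0..t} Y'" if "t \<in> {0..\<tau>}" for t
    using y y' that by (auto simp: d_def d'_def mild_def Y_def[abs_def] Y'_def[abs_def])
  have diff: "norm (y t - y' t) \<le> c * \<delta>" if t: "t \<in> {0..\<tau>}" for t
  proof -
    have "norm (y t - y' t) \<le> 2 * norm (x - x') * exp (4 * K * M * t)"
      by (rule mild_diff[OF y y' M t])
    \<comment> \<open>Here \<open>\<tau> \<le> 1\<close> removes the time from the exponent, so that
      \<open>c\<close> is independent of \<open>\<tau>\<close>.\<close>
    also have "\<dots> \<le> 2 * norm (x - x') * exp (4 * K * M)"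
      using t \<tau> K_pos \<open>M > 0\<close> by (intro mult_left_mono) (auto intro: mult_left_le)
    finally show ?thesis by (simp add: c_def \<delta>_def mult_ac)
  qed
  have nd: "norm (d t) \<le> K * M * M * t" "norm (d' t) \<le> K * M * M * t" if t: "t \<in> {0..\<tau>}" for t
    unfolding d[OF t] using t by (auto intro!: norm_integral_le cY cY' norm_N_le M simp: Y_def Y'_def)
  have ndd: "norm (d t - d' t) \<le> 2 * K * M * (c * \<delta>) * t" if t: "t \<in> {0..\<tau>}" for t
  proof -
    have "d t - d' t = integral {0..t} (\<lambda>s. Y s - Y' s)"
      by (simp add: d[OF t] Henstock_Kurzweil_Integration.integral_diff
          integrable_continuous_interval cY[OF t] cY'[OF t])
    also have "norm \<dots> \<le> 2 * K * M * (c * \<delta>) * t"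
    proof (intro norm_integral_le continuous_intros cY cY' t)
      fix s assume "s \<in> {0..t}"
      then have s: "s \<in> {0..\<tau>}" using t by auto
      have "norm (Y s - Y' s) \<le> 2 * K * M * norm (y s - y' s)"
        unfolding Y_def Y'_def by (intro norm_N_diff M s)
      also have "\<dots> \<le> 2 * K * M * (c * \<delta>)"
        using K_pos \<open>M > 0\<close> by (intro mult_left_mono diff s) auto
      finally show "norm (Y s - Y' s) \<le> 2 * K * M * (c * \<delta>)" .
    qed (use t in auto)
    finally show ?thesis .
  qed
  have \<tau>\<tau>: "\<tau> \<in> {0..\<tau>}" and "0 \<in> {0..\<tau>}" using \<tau> by auto
  have xM: "norm x \<le> M" "norm x' \<le> M"
    using M(1,2)[OF \<open>0 \<in> {0..\<tau>}\<close>] y y' \<open>0 \<in> {0..\<tau>}\<close> by (auto simp: mild_def)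
  have cx: "continuous_on A (\<lambda>s. N s z z)" for z A by (intro continuous_N continuous_intros)
  let ?g = "\<lambda>s. (Y s - N s x x) - (Y' s - N s x' x')"
  have "integral {0..\<tau>} ?g = (integral {0..\<tau>} Y - integral {0..\<tau>} (\<lambda>s. N s x x))
      - (integral {0..\<tau>} Y' - integral {0..\<tau>} (\<lambda>s. N s x' x'))"
    by (simp add: Henstock_Kurzweil_Integration.integral_diff integrable_continuous_interval
        integrable_diff cY[OF \<tau>\<tau>] cY'[OF \<tau>\<tau>] cx)
  then have "(y \<tau> - picard1 \<tau> x) - (y' \<tau> - picard1 \<tau> x') = integral {0..\<tau>} ?g"
    using d[OF \<tau>\<tau>] by (simp add: d_def d'_def picard1_def algebra_simps)
  also have "norm \<dots> \<le> (K\<^sup>2 * M\<^sup>2 * (5 * c + 1) * \<delta> * \<tau>) * \<tau>"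
  proof (intro norm_integral_le continuous_intros cY cY' \<tau>\<tau> cx)
    fix s assume s: "s \<in> {0..\<tau>}"
    have eq: "?g s = (N s (d s - d' s) (y s) + N s (d' s) (y s - y' s))
        + (N s (x - x') (d s) + N s x' (d s - d' s))"
      by (simp add: Y_def Y'_def d_def d'_def N_diff_left N_diff_right
          bounded_bilinear.add_left[OF bilinear] bounded_bilinear.add_right[OF bilinear] algebra_simps)
    \<comment> \<open>In units of \<open>K\<^sup>2 * M\<^sup>2 * \<delta> * s\<close> the four terms
      count \<open>2 * c\<close>, \<open>c\<close>, 1 and \<open>2 * c\<close>.\<close>
    have "norm (?g s) \<le> (K * (2 * K * M * (c * \<delta>) * s) * M + K * (K * M * M * s) * (c * \<delta>))
        + (K * \<delta> * (K * M * M * s) + K * M * (2 * K * M * (c * \<delta>) * s))"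
      unfolding eq by (intro norm_triangle_mono norm_N_le ndd nd diff s M xM) (simp add: \<delta>_def)
    also have "\<dots> = K\<^sup>2 * M\<^sup>2 * (5 * c + 1) * \<delta> * s"
      by (simp add: algebra_simps power2_eq_square)
    also have "\<dots> \<le> K\<^sup>2 * M\<^sup>2 * (5 * c + 1) * \<delta> * \<tau>"
      using s by (intro mult_left_mono) (auto simp: c_def \<delta>_def)
    finally show "norm (?g s) \<le> K\<^sup>2 * M\<^sup>2 * (5 * c + 1) * \<delta> * \<tau>" .
  qed (use \<tau> in auto)
  finally show ?thesis by (simp add: c_def \<delta>_def power2_eq_square mult_ac)
qed

end

section \<open>Uniqueness of Fourier coefficients\<close>

lemma finite_measure_torus: "finite_measure torus"
  by (intro finite_measure_lebesgue_on) auto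

lemma borel_measurable_torus_continuous:
  "continuous_on UNIV f \<Longrightarrow> f \<in> borel_measurable torus" for f :: "real \<Rightarrow> 'b::euclidean_space"
  by (rule continuous_imp_measurable_on_sets_lebesgue) (auto intro: continuous_on_subset)

lemma integrable_torus_bounded:
  fixes g :: "real \<Rightarrow> complex"
  assumes "g \<in> borel_measurable torus" "\<And>x. cmod (g x) \<le> c"
  shows "integrable torus g"
  using assms by (intro finite_measure.integrable_const_bound[OF finite_measure_torus, of _ c]) auto

lemma integrable_torus_mult:
  fixes f g :: "real \<Rightarrow> complex"
  assumes f: "integrable torus f" and g: "g \<in> borel_measurable torus" "\<And>x. cmod (g x) \<le> c"
  shows "integrable torus (\<lambda>x. g x * f x)"
proof (rule Bochner_Integration.integrable_bound)
  show "integrable torus (\<lambda>x. c *\<^sub>R f x)" using f by auto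
  show "(\<lambda>x. g x * f x) \<in> borel_measurable torus" using f g by measurable
  show "AE x in torus. norm (g x * f x) \<le> norm (c *\<^sub>R f x)"
    using g(2) by (intro AE_I2) (auto simp: norm_mult intro!: mult_right_mono order_trans[OF _ abs_ge_self])
qed

lemma cis_measurable_torus [measurable]: "(\<lambda>x. cis (c * x)) \<in> borel_measurable torus"
  by (intro borel_measurable_torus_continuous continuous_intros)

lemma integrable_torus_cis:
  "integrable torus f \<Longrightarrow> integrable torus (\<lambda>x. f x * cis (c * x))"
  using integrable_torus_mult[OF _ cis_measurable_torus, of f c 1] by (simp add: mult.commute)

text \<open>The sign in the exponent is immaterial as \<open>j\<close> runs over all integers.
  Collecting these functions in a set prepares the induction over polynomials: the set is a module
  over the trigonometric polynomials.\<close>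

definition zero_modes :: "(real \<Rightarrow> complex) set" where
  "zero_modes = {g. integrable torus g \<and> (\<forall>j::int. (LINT x|torus. g x * cis (of_int j * x)) = 0)}"

lemma zero_modes_cis:
  assumes "g \<in> zero_modes"
  shows "(\<lambda>x. c * cis (of_int k * x) * g x) \<in> zero_modes"
proof -
  have "(LINT x|torus. c * cis (of_int k * x) * g x * cis (of_int j * x)) = 0" for j
  proof -
    have "(LINT x|torus. c * cis (of_int k * x) * g x * cis (of_int j * x))
        = (LINT x|torus. c * (g x * cis (of_int (j + k) * x)))"
      by (intro Bochner_Integration.integral_cong) (auto simp: cis_mult[symmetric] algebra_simps)
    also have "\<dots> = c * (LINT x|torus. g x * cis (of_int (j + k) * x))" by simp
    also have "\<dots> = 0" using assms unfolding zero_modes_def by (simp del: of_int_add)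
    finally show ?thesis .
  qed
  moreover have "integrable torus (\<lambda>x. c * (g x * cis (of_int k * x)))"
    using assms by (intro integrable_mult_right integrable_torus_cis) (auto simp: zero_modes_def)
  ultimately show ?thesis by (simp add: zero_modes_def mult_ac)
qed

lemma zero_modes_add:
  assumes "g \<in> zero_modes" "h \<in> zero_modes"
  shows "(\<lambda>x. g x + h x) \<in> zero_modes"
  using assms by (simp add: zero_modes_def distrib_right integrable_torus_cis)

text \<open>A polynomial in the real and imaginary part of \<open>cis x\<close> is a trigonometric
  polynomial. In the linear case Euler's formulas produce the modes 1 and -1; the product case
  applies the two induction hypotheses one after the other, hence the arbitrary
  \<open>g\<close>.\<close>

lemma zero_modes_polynomial:
  assumes "real_polynomial_function p" "g \<in> zero_modes"
  shows "(\<lambda>x. of_real (p (cis x)) * g x) \<in> zero_modes"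
  using assms
proof (induction arbitrary: g rule: real_polynomial_function.induct)
  case (linear L)
  interpret L: bounded_linear L by fact
  have "L (cis x) = cos x * L 1 + sin x * L \<i>" for x
  proof -
    have "cis x = cos x *\<^sub>R 1 + sin x *\<^sub>R \<i>" by (simp add: complex_eq_iff)
    then show ?thesis by (metis L.add L.scaleR real_scaleR_def)
  qed
  then have "complex_of_real (L (cis x)) = (L 1 - \<i> * L \<i>) / 2 * cis (of_int 1 * x)
      + (L 1 + \<i> * L \<i>) / 2 * cis (of_int (- 1) * x)" for x
    by (simp add: complex_eq_iff field_simps)
  then show ?case
    using zero_modes_add[OF zero_modes_cis[OF linear(2), of "(L 1 - \<i> * L \<i>) / 2" 1]
        zero_modes_cis[OF linear(2), of "(L 1 + \<i> * L \<i>) / 2" "- 1"]]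
    by (simp add: distrib_right)
next
  case (const c)
  then show ?case using zero_modes_cis[of g "of_real c" 0] by simp
next
  case (add p q)
  then show ?case using zero_modes_add by (simp add: distrib_right)
next
  case (mult p q)
  then show ?case by (simp add: mult.assoc)
qed

text \<open>Stone-Weierstrass on the unit circle rather than on an interval: continuity on
  \<open>sphere 0 1\<close> already encodes periodicity.\<close>

lemma zero_modes_integral_continuous:
  fixes h :: "complex \<Rightarrow> real"
  assumes f: "f \<in> zero_modes" and h: "continuous_on (sphere 0 1) h"
  shows "(LINT x|torus. of_real (h (cis x)) * f x) = 0"
proof -
  have int: "integrable torus (\<lambda>x. of_real (q (cis x)) * f x)" if "continuous_on (sphere 0 1) q" for q
  proof -
    have "compact (q ` sphere 0 1)" using that by (intro compact_continuous_image) auto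
    then obtain c where "\<forall>z\<in>sphere 0 1. norm (q z) \<le> c"
      using compact_imp_bounded bounded_iff by (metis image_eqI)
    moreover have "continuous_on UNIV (\<lambda>x. complex_of_real (q (cis x)))"
      by (intro continuous_on_of_real continuous_on_compose2[OF that] continuous_intros) auto
    ultimately show ?thesis
      using f by (intro integrable_torus_mult[of _ _ c] borel_measurable_torus_continuous)
        (auto simp: zero_modes_def)
  qed
  define A where "A = (LINT x|torus. cmod (f x))"
  have A: "0 \<le> A" unfolding A_def by simp
  have "cmod (LINT x|torus. of_real (h (cis x)) * f x) \<le> e" if "e > 0" for e
  proof -
    \<comment> \<open>\<open>A + 1\<close> instead of \<open>A\<close> avoids division by zero when
      \<open>f\<close> vanishes almost everywhere.\<close>
    have "e / (A + 1) > 0" using that A by simp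
    then obtain p where p: "real_polynomial_function p"
        "\<And>z. z \<in> sphere 0 1 \<Longrightarrow> \<bar>h z - p z\<bar> < e / (A + 1)"
      using Stone_Weierstrass_real_polynomial_function[OF compact_sphere h] by metis
    have cp: "continuous_on (sphere 0 1) p"
      using p(1) by (simp add: continuous_on_polymonial_function real_polynomial_function_eq)
    have chp: "continuous_on (sphere 0 1) (\<lambda>z. h z - p z)" by (intro continuous_intros h cp)
    have "(LINT x|torus. of_real (p (cis x)) * f x) = 0"
    proof -
      have "(LINT x|torus. of_real (p (cis x)) * f x * cis (of_int 0 * x)) = 0"
        using zero_modes_polynomial[OF p(1) f] unfolding zero_modes_def by blast
      then show ?thesis by simp
    qed
    then have "(LINT x|torus. of_real (h (cis x)) * f x)
        = (LINT x|torus. of_real (h (cis x)) * f x - of_real (p (cis x)) * f x)"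
      using int[OF h] int[OF cp] by simp
    also have "\<dots> = (LINT x|torus. of_real (h (cis x) - p (cis x)) * f x)"
      by (simp add: left_diff_distrib)
    also have "cmod \<dots> \<le> (LINT x|torus. e / (A + 1) * cmod (f x))"
    proof (rule Bochner_Integration.integral_norm_bound_integral)
      show "integrable torus (\<lambda>x. complex_of_real (h (cis x) - p (cis x)) * f x)" by (rule int[OF chp])
      show "integrable torus (\<lambda>x. e / (A + 1) * cmod (f x))" using f by (auto simp: zero_modes_def)
      show "norm (complex_of_real (h (cis x) - p (cis x)) * f x) \<le> e / (A + 1) * cmod (f x)" for x
        using p(2)[of "cis x"] unfolding norm_mult norm_of_real by (intro mult_right_mono) auto
    qed
    also have "\<dots> = e * (A / (A + 1))" by (simp add: A_def)
    also have "\<dots> \<le> e" using A that by (intro mult_left_le) auto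
    finally show ?thesis .
  qed
  then have "cmod (LINT x|torus. of_real (h (cis x)) * f x) \<le> 0" by (rule field_le_epsilon[of _ 0, simplified])
  then show ?thesis by simp
qed

lemma cis_inj_on: "inj_on cis {0<..<2 * pi}"
proof (rule inj_onI)
  fix x y assume x: "x \<in> {0<..<2 * pi}" and y: "y \<in> {0<..<2 * pi}" and "cis x = cis y"
  then obtain n :: int where n: "x = y + 2 * pi * n"
    using sin_cos_eq_iff[of x y] by (auto simp: complex_eq_iff)
  have "\<not> 1 \<le> n"
  proof
    assume "1 \<le> n"
    then have "2 * pi * 1 \<le> 2 * pi * real_of_int n" by (intro mult_left_mono) auto
    then show False using n x y unfolding greaterThanLessThan_iff by linarith
  qed
  moreover have "\<not> n \<le> - 1"
  proof
    assume "n \<le> - 1"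
    then have "2 * pi * real_of_int n \<le> 2 * pi * (- 1)" by (intro mult_left_mono) auto
    then show False using n x y unfolding greaterThanLessThan_iff by linarith
  qed
  ultimately have "n = 0" by linarith
  with n show "x = y" by simp
qed

text \<open>The indicator of \<open>C\<close> is the pointwise limit of \<open>h n (cis x)\<close>,
  continuous functions on the circle with values between 0 and 1. Injectivity of \<open>cis\<close>
  on the open interval guarantees that points outside \<open>C\<close> have positive distance from
  the compact image of \<open>C\<close>.\<close>

lemma zero_modes_integral_closed:
  assumes f: "f \<in> zero_modes" and C: "closed C" "C \<subseteq> {0<..<2 * pi}"
  shows "(LINT x|torus. indicat_real C x *\<^sub>R f x) = 0"
proof (cases "C = {}")
  case False
  have "compact C" using C by (metis bounded_subset bounded_box compact_eq_bounded_closed box_real(1))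
  then have K: "closed (cis ` C)" by (intro compact_imp_closed compact_continuous_image continuous_intros) auto
  define h where "h n z = max 0 (1 - real n * infdist z (cis ` C))" for n z
  have h01: "0 \<le> h n z" "h n z \<le> 1" for n z by (auto simp: h_def infdist_nonneg)
  have ch: "continuous_on A (h n)" for A n unfolding h_def by (intro continuous_intros)
  have lim: "(\<lambda>n. h n (cis x)) \<longlonglongrightarrow> indicat_real C x" if x: "x \<in> {0<..<2 * pi}" for x
  proof (cases "x \<in> C")
    case True
    then show ?thesis by (simp add: h_def infdist_zero)
  next
    case False
    have "cis x \<notin> cis ` C" using inj_onD[OF cis_inj_on _ x] C False by blast
    then have d: "infdist (cis x) (cis ` C) > 0"
      using K \<open>C \<noteq> {}\<close> infdist_nonneg[of "cis x" "cis ` C"] by (simp add: in_closed_iff_infdist_zero less_le)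
    obtain m :: nat where m: "1 < real m * infdist (cis x) (cis ` C)"
      using reals_Archimedean3[OF d] by blast
    have "\<forall>\<^sub>F n in sequentially. h n (cis x) = 0"
    proof (rule eventually_sequentiallyI)
      fix n assume "m \<le> n"
      then have "real m * infdist (cis x) (cis ` C) \<le> real n * infdist (cis x) (cis ` C)"
        using d by (intro mult_right_mono) auto
      then show "h n (cis x) = 0" using m by (simp add: h_def)
    qed
    then show ?thesis using False by (simp add: tendsto_eventually)
  qed
  have fi: "integrable torus f" using f by (simp add: zero_modes_def)
  have "(\<lambda>n. LINT x|torus. of_real (h n (cis x)) * f x)
      \<longlonglongrightarrow> (LINT x|torus. indicat_real C x *\<^sub>R f x)"
  proof (rule integral_dominated_convergence[where w = "\<lambda>x. cmod (f x)"])
    have "indicat_real C \<in> borel_measurable torus"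
      using C by (intro borel_measurable_indicator) (auto simp: sets_restrict_space_iff)
    then show "(\<lambda>x. indicat_real C x *\<^sub>R f x) \<in> borel_measurable torus" using fi by measurable
    have "(\<lambda>x. complex_of_real (h n (cis x))) \<in> borel_measurable torus" for n
      by (intro borel_measurable_torus_continuous continuous_on_of_real continuous_on_compose2[OF ch]
          continuous_intros) auto
    then show "(\<lambda>x. of_real (h n (cis x)) * f x) \<in> borel_measurable torus" for n
      using fi by measurable
    show "integrable torus (\<lambda>x. cmod (f x))" using fi by simp
    show "AE x in torus. (\<lambda>n. of_real (h n (cis x)) * f x) \<longlonglongrightarrow> indicat_real C x *\<^sub>R f x"
      by (intro AE_I2) (auto simp: scaleR_conv_of_real intro!: tendsto_intros lim)
    show "AE x in torus. norm (of_real (h n (cis x)) * f x) \<le> cmod (f x)" for n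
      using h01 by (intro AE_I2) (auto simp: norm_mult intro!: mult_left_le_one_le)
  qed
  moreover have "(LINT x|torus. of_real (h n (cis x)) * f x) = 0" for n
    by (rule zero_modes_integral_continuous[OF f ch])
  ultimately show ?thesis by (simp add: LIMSEQ_const_iff)
qed simp

text \<open>Up to a null set a measurable set is an increasing union of closed sets, so the integral
  of \<open>f\<close> over every measurable set vanishes by dominated convergence, which forces
  \<open>f\<close> to vanish almost everywhere.\<close>

lemma zero_modes_AE:
  assumes f: "f \<in> zero_modes"
  shows "AE x in torus. f x = 0"
proof (rule sigma_finite_measure.density_zero)
  show "sigma_finite_measure torus"
    using finite_measure_torus by (rule finite_measure.axioms)
  show fi: "integrable torus f" using f by (simp add: zero_modes_def)
  fix A assume "A \<in> sets torus"
  then have A: "A \<in> sets lebesgue" "A \<subseteq> {0<..<2 * pi}" by (auto simp: sets_restrict_space_iff)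
  obtain C T where CT: "fsigma C" "T \<in> null_sets lebesgue" "C \<union> T = A" "disjnt C T"
    using lebesgue_set_almost_fsigma[OF A(1)] by blast
  then obtain F :: "nat \<Rightarrow> real set" where F: "\<And>n. closed (F n)" "C = (\<Union>n. F n)"
    by (auto elim: fsigma.cases)
  define D where "D n = (\<Union>i\<le>n. F i)" for n
  have D: "closed (D n)" "D n \<subseteq> C" for n unfolding D_def F(2) by (auto intro: F)
  have CA: "C \<subseteq> {0<..<2 * pi}" using CT A by auto
  have meas: "indicat_real B \<in> borel_measurable torus" if "B \<in> sets lebesgue" "B \<subseteq> {0<..<2 * pi}" for B
    using that by (intro borel_measurable_indicator) (auto simp: sets_restrict_space_iff)
  have Dm: "indicat_real (D n) \<in> borel_measurable torus" for n
    using D[of n] CA by (intro meas) auto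
  have Cm: "C \<in> sets lebesgue" using F by auto
  have "(\<lambda>n. LINT x|torus. indicat_real (D n) x *\<^sub>R f x) \<longlonglongrightarrow> (LINT x|torus. indicat_real A x *\<^sub>R f x)"
  proof (rule integral_dominated_convergence[where w = "\<lambda>x. cmod (f x)"])
    show "(\<lambda>x. indicat_real A x *\<^sub>R f x) \<in> borel_measurable torus" using meas[OF A] fi by measurable
    show "(\<lambda>x. indicat_real (D n) x *\<^sub>R f x) \<in> borel_measurable torus" for n
      using Dm[of n] fi by measurable
    show "integrable torus (\<lambda>x. cmod (f x))" using fi by simp
    have "AE x in lebesgue. x \<notin> T" using CT(2) by (rule AE_not_in)
    then have T: "AE x in torus. x \<notin> T" by (subst AE_restrict_space_iff) auto
    show "AE x in torus. (\<lambda>n. indicat_real (D n) x *\<^sub>R f x) \<longlonglongrightarrow> indicat_real A x *\<^sub>R f x"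
      using T
    proof eventually_elim
      case (elim x)
      have "\<forall>\<^sub>F n in sequentially. indicat_real (D n) x = indicat_real A x"
      proof (cases "x \<in> C")
        case True
        then obtain m where "x \<in> F m" using F by auto
        then have "x \<in> D n" if "m \<le> n" for n using that by (auto simp: D_def)
        then show ?thesis
          using True CT(3) by (intro eventually_sequentiallyI[of m]) auto
      next
        case False
        then have "x \<notin> A" "x \<notin> D n" for n using D(2) CT(3) elim by auto
        then show ?thesis by simp
      qed
      then have "\<forall>\<^sub>F n in sequentially. indicat_real (D n) x *\<^sub>R f x = indicat_real A x *\<^sub>R f x"
        by eventually_elim simp
      then show ?case by (rule tendsto_eventually)
    qed
    show "AE x in torus. norm (indicat_real (D n) x *\<^sub>R f x) \<le> cmod (f x)" for n
      by (intro AE_I2) (auto simp: indicator_def)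
  qed
  moreover have "(LINT x|torus. indicat_real (D n) x *\<^sub>R f x) = 0" for n
    using D CA by (intro zero_modes_integral_closed[OF f]) auto
  ultimately show "set_lebesgue_integral torus A f = 0"
    by (simp add: LIMSEQ_const_iff set_lebesgue_integral_def)
qed

lemma fourier_coeff_zero_AE:
  assumes "integrable torus f" "\<And>k. fourier_coeff f k = 0"
  shows "AE x in torus. f x = 0"
proof (rule zero_modes_AE)
  have "(LINT x|torus. f x * cis (of_int j * x)) = 0" for j
    using assms(2)[of "- j"] by (simp add: fourier_coeff_def)
  then show "f \<in> zero_modes" using assms(1) by (simp add: zero_modes_def)
qed

lemma fourier_coeff_diff:
  assumes "integrable torus f" "integrable torus g"
  shows "fourier_coeff (\<lambda>x. f x - g x) k = fourier_coeff f k - fourier_coeff g k"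
  using integrable_torus_cis[OF assms(1), of "- of_int k"] integrable_torus_cis[OF assms(2), of "- of_int k"]
  by (simp add: fourier_coeff_def left_diff_distrib diff_divide_distrib)

lemma fourier_coeff_add:
  assumes "integrable torus f" "integrable torus g"
  shows "fourier_coeff (\<lambda>x. f x + g x) k = fourier_coeff f k + fourier_coeff g k"
  using integrable_torus_cis[OF assms(1), of "- of_int k"] integrable_torus_cis[OF assms(2), of "- of_int k"]
  by (simp add: fourier_coeff_def distrib_right add_divide_distrib)

lemma fourier_coeff_cong_AE:
  assumes "AE x in torus. f x = g x" "f \<in> borel_measurable torus" "g \<in> borel_measurable torus"
  shows "fourier_coeff f k = fourier_coeff g k"
proof -
  have "(LINT x|torus. f x * cis (- (of_int k * x))) = (LINT x|torus. g x * cis (- (of_int k * x)))"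
    using assms cis_measurable_torus[of "- of_int k"] by (intro integral_cong_AE) auto
  then show ?thesis by (simp add: fourier_coeff_def)
qed

section \<open>Integrals of complex exponentials and orthogonality\<close>

lemma has_vector_derivative_cis:
  "((\<lambda>s. cis (c * s)) has_vector_derivative (\<i> * of_real c * cis (c * t))) (at t within A)"
  unfolding has_vector_derivative_def
  by (auto intro!: derivative_eq_intros simp: scaleR_conv_of_real fun_eq_iff)

text \<open>Used twice: over a full period with integer \<open>\<theta>\<close> it yields
  orthogonality of the modes, and with \<open>\<theta> = 2 * a * b\<close> it integrates the phase
  of the interaction of the modes \<open>a\<close> and \<open>b\<close>. The case
  \<open>\<theta> = 0\<close> is the resonance.\<close>

lemma has_integral_cis:
  assumes "0 \<le> \<tau>"
  shows "((\<lambda>s. cis (\<theta> * s)) has_integral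
    (if \<theta> = 0 then of_real \<tau> else (cis (\<theta> * \<tau>) - 1) / (\<i> * of_real \<theta>))) {0..\<tau>}"
proof (cases "\<theta> = 0")
  case True
  then show ?thesis
    using has_integral_const_real[of "1::complex" 0 \<tau>] assms by (simp add: scaleR_conv_of_real)
next
  case False
  let ?F = "\<lambda>s. cis (\<theta> * s) / (\<i> * of_real \<theta>)"
  have "((\<lambda>s. cis (\<theta> * s)) has_integral ?F \<tau> - ?F 0) {0..\<tau>}"
  proof (rule fundamental_theorem_of_calculus[OF assms])
    fix s
    have "(?F has_vector_derivative (\<i> * of_real \<theta> * cis (\<theta> * s)) / (\<i> * of_real \<theta>)) (at s within {0..\<tau>})"
      by (intro has_vector_derivative_divide has_vector_derivative_cis)
    then show "(?F has_vector_derivative cis (\<theta> * s)) (at s within {0..\<tau>})" using False by simp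
  qed
  then show ?thesis using False by (simp add: diff_divide_distrib)
qed

lemma has_integral_cis_int:
  "((\<lambda>x. cis (of_int k * x)) has_integral (if k = 0 then 2 * pi else 0)) {0<..<2 * pi}"
proof -
  have "cis (of_int k * (2 * pi)) = 1"
    using cis_multiple_2pi[of "of_int k"] by (simp add: mult_ac)
  then show ?thesis
    using has_integral_cis[of "2 * pi" "of_int k"] by (auto simp: has_integral_Icc_iff_Ioo split: if_splits)
qed

lemma fourier_coeff_cis: "fourier_coeff (\<lambda>x. c * cis (of_int j * x)) k = (if j = k then c else 0)"
proof -
  have "integrable torus (\<lambda>x. cis (of_int (j - k) * x))"
    by (intro integrable_torus_bounded[of _ 1]) auto
  then have "(LINT x|torus. cis (of_int (j - k) * x)) = integral {0<..<2 * pi} (\<lambda>x. cis (of_int (j - k) * x))"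
    by (intro lebesgue_integral_eq_integral) auto
  also have "\<dots> = (if j = k then 2 * pi else 0)"
    using integral_unique[OF has_integral_cis_int[of "j - k"]] by simp
  also have "(LINT x|torus. cis (of_int (j - k) * x)) = (LINT x|torus. cis (of_int j * x) * cis (- (of_int k * x)))"
    by (simp add: cis_mult algebra_simps)
  finally show ?thesis by (simp add: fourier_coeff_def mult.assoc)
qed

section \<open>Auxiliary facts on sums and families of operators\<close>

lemma summable_on_bounded_sums:
  fixes f :: "'a \<Rightarrow> 'b::banach"
  assumes "\<And>F. finite F \<Longrightarrow> (\<Sum>k\<in>F. norm (f k)) \<le> c"
  shows "f summable_on UNIV" "norm (\<Sum>\<^sub>\<infinity>k. f k) \<le> c"
proof -
  have *: "f abs_summable_on UNIV"
    using assms by (auto simp: abs_summable_iff_bdd_above bdd_above_def)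
  then show "f summable_on UNIV" by (rule abs_summable_summable)
  show "norm (\<Sum>\<^sub>\<infinity>k. f k) \<le> c"
    using norm_infsum_bound[OF *] infsum_le_finite_sums[OF *, of c] assms by fastforce
qed

lemma infsum_eq_single:
  assumes "\<And>j. j \<noteq> i \<Longrightarrow> f j = 0"
  shows "(\<Sum>\<^sub>\<infinity>j. f j) = f i"
proof -
  have "(\<Sum>\<^sub>\<infinity>j. f j) = (\<Sum>\<^sub>\<infinity>j\<in>{i}. f j)" by (rule infsum_cong_neutral) (use assms in auto)
  then show ?thesis by simp
qed

lemma bounded_bilinear_linear_compose:
  assumes f: "bounded_linear f" and g: "bounded_bilinear g"
  shows "bounded_bilinear (\<lambda>x y. f (g x y))"
proof -
  interpret f: bounded_linear f by fact
  interpret g: bounded_bilinear g by fact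
  obtain a where a: "\<And>x. norm (f x) \<le> norm x * a" and "a \<ge> 0"
    using f.nonneg_bounded by blast
  obtain b where b: "\<And>x y. norm (g x y) \<le> norm x * norm y * b" using g.bounded by blast
  show ?thesis
  proof
    show "\<exists>K. \<forall>x y. norm (f (g x y)) \<le> norm x * norm y * K"
      using order_trans[OF a mult_right_mono[OF b \<open>a \<ge> 0\<close>]]
      by (intro exI[of _ "b * a"]) (simp add: mult.assoc)
  qed (simp_all add: f.add f.scaleR g.add_left g.add_right g.scaleR_left g.scaleR_right)
qed

lemma norm_single: "norm (single k c) = cmod c"
proof -
  have "(norm (single k c))\<^sup>2 = (cmod c)\<^sup>2"
    unfolding norm_ell2_power2 by (subst infsum_eq_single[of k]) auto
  then show ?thesis by simp
qed

lemma bounded_linear_single: "bounded_linear (single k)"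
  by (rule bounded_linear_intro[of _ 1]) (auto intro!: ell2_eqI simp: norm_single scaleR_conv_of_real)

text \<open>Strong continuity from single modes. The bound uniform in \<open>t\<close> makes the
  convergence of partial sums uniform in \<open>t\<close>, which settles fixed arguments; a moving
  argument is split as \<open>f t (u t - u a) + f t (u a)\<close>.\<close>

lemma continuous_on_bounded_linear_family:
  fixes f :: "'s::metric_space \<Rightarrow> 'a ell2 \<Rightarrow> 'b::real_normed_vector"
  assumes lin: "\<And>t. bounded_linear (f t)" and le: "\<And>t x. norm (f t x) \<le> C * norm x"
    and single: "\<And>k c. continuous_on A (\<lambda>t. f t (single k c))"
    and u: "continuous_on A u"
  shows "continuous_on A (\<lambda>t. f t (u t))"
proof -
  have const: "continuous_on A (\<lambda>t. f t x)" for x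
  proof (rule uniform_limit_theorem[where F = "finite_subsets_at_top UNIV"])
    let ?s = "\<lambda>F. \<Sum>k\<in>F. single k (coord x k)"
    have "f t (?s F) = (\<Sum>k\<in>F. f t (single k (coord x k)))" for t F
      by (rule linear_sum[OF bounded_linear.linear[OF lin]])
    then have "continuous_on A (\<lambda>t. f t (?s F))" for F
      by (simp only:) (intro continuous_intros single)
    then show "\<forall>\<^sub>F F in finite_subsets_at_top UNIV. continuous_on A (\<lambda>t. f t (?s F))" by simp
    show "uniform_limit A (\<lambda>F t. f t (?s F)) (\<lambda>t. f t x) (finite_subsets_at_top UNIV)"
    proof (rule uniform_limitI)
      fix e :: real assume "e > 0"
      then have "e / (\<bar>C\<bar> + 1) > 0" by simp
      then have "\<forall>\<^sub>F F in finite_subsets_at_top UNIV. dist (?s F) x < e / (\<bar>C\<bar> + 1)"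
        using has_sum_single[of x] unfolding has_sum_def by (rule tendstoD[rotated])
      then show "\<forall>\<^sub>F F in finite_subsets_at_top UNIV. \<forall>t\<in>A. dist (f t (?s F)) (f t x) < e"
      proof eventually_elim
        case (elim F)
        show ?case
        proof
          fix t
          have "dist (f t (?s F)) (f t x) = norm (f t (?s F - x))"
            using bounded_linear.linear[OF lin[of t]] by (simp add: dist_norm linear_diff)
          also have "\<dots> \<le> C * norm (?s F - x)" by (rule le)
          also have "\<dots> \<le> (\<bar>C\<bar> + 1) * norm (?s F - x)" by (intro mult_right_mono) auto
          also have "\<dots> < e" using elim by (simp add: dist_norm pos_less_divide_eq mult.commute add_pos_nonneg)
          finally show "dist (f t (?s F)) (f t x) < e" .
        qed
      qed
    qed
  qed simp
  show ?thesis unfolding continuous_on_def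
  proof
    fix a assume a: "a \<in> A"
    have "((\<lambda>t. f t (u t - u a)) \<longlongrightarrow> 0) (at a within A)"
    proof (rule Lim_null_comparison)
      show "\<forall>\<^sub>F t in at a within A. norm (f t (u t - u a)) \<le> C * norm (u t - u a)" by (simp add: le)
      have "(u \<longlongrightarrow> u a) (at a within A)" using u a by (simp add: continuous_on_def)
      then have "((\<lambda>t. C * norm (u t - u a)) \<longlongrightarrow> C * norm (u a - u a)) (at a within A)"
        by (intro tendsto_intros)
      then show "((\<lambda>t. C * norm (u t - u a)) \<longlongrightarrow> 0) (at a within A)" by simp
    qed
    moreover have "((\<lambda>t. f t (u a)) \<longlongrightarrow> f a (u a)) (at a within A)"
      using const a by (simp add: continuous_on_def)
    ultimately have "((\<lambda>t. f t (u t - u a) + f t (u a)) \<longlongrightarrow> 0 + f a (u a)) (at a within A)"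
      by (rule tendsto_add)
    then show "((\<lambda>t. f t (u t)) \<longlongrightarrow> f a (u a)) (at a within A)"
      using bounded_linear.linear[OF lin] by (simp add: linear_diff)
  qed
qed

section \<open>Sobolev spaces in weighted coordinates\<close>

locale sobolev_space =
  fixes r :: real
  assumes r: "r > 1/2"
begin

definition w :: "int \<Rightarrow> real" where "w k = (1 + (of_int k)\<^sup>2) powr (r / 2)"

lemma w_pos [simp]: "w k > 0" "w k \<noteq> 0"
proof -
  have "1 + (real_of_int k)\<^sup>2 > 0" by (simp add: add_pos_nonneg)
  then show "w k > 0" by (simp add: w_def)
  then show "w k \<noteq> 0" by simp
qed

lemma w_0 [simp]: "w 0 = 1"
  by (simp add: w_def)

lemma w_power2: "(w k)\<^sup>2 = (1 + (of_int k)\<^sup>2) powr r"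
  by (simp add: w_def power2_eq_square powr_add[symmetric])

text \<open>The threshold \<open>r > 1/2\<close> is decisive here: the terms are dominated by powers
  of exponent \<open>- (2 * r) < - 1\<close>. The integers are covered by two half-lines, which may
  overlap at 0.\<close>

lemma summable_inverse_w: "(\<lambda>k. 1 / (w k)\<^sup>2) summable_on UNIV"
proof -
  have nat: "(\<lambda>n::nat. 1 / (w (int n))\<^sup>2) summable_on UNIV"
  proof (rule summable_nonneg_imp_summable_on)
    show "summable (\<lambda>n::nat. 1 / (w (int n))\<^sup>2)"
    proof (rule summable_comparison_test')
      show "summable (\<lambda>n::nat. real n powr (- (2 * r)))"
        using r by (subst summable_real_powr_iff) auto
      show "norm (1 / (w (int n))\<^sup>2) \<le> real n powr (- (2 * r))" if "1 \<le> n" for n :: nat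
      proof -
        have "real n powr (2 * r) = ((real n)\<^sup>2) powr r"
          using that by (simp add: powr_powr[symmetric] powr_numeral)
        also have "\<dots> \<le> (1 + (real n)\<^sup>2) powr r" using r by (intro powr_mono2) auto
        finally have "1 / (1 + (real n)\<^sup>2) powr r \<le> 1 / real n powr (2 * r)"
          using that by (intro frac_le) auto
        then show ?thesis by (simp add: w_power2 powr_minus_divide)
      qed
    qed
  qed simp
  have inj: "inj_on int UNIV" "inj_on (\<lambda>n. - int n) UNIV" by (auto simp: inj_on_def)
  have "(\<lambda>k. 1 / (w k)\<^sup>2) summable_on range int"
    "(\<lambda>k. 1 / (w k)\<^sup>2) summable_on range (\<lambda>n. - int n)"
    using nat by (auto simp: summable_on_reindex[OF inj(1)] summable_on_reindex[OF inj(2)] o_def w_def)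
  then have "(\<lambda>k. 1 / (w k)\<^sup>2) summable_on (range int \<union> range (\<lambda>n. - int n))"
    by (rule summable_on_union)
  moreover have "range int \<union> range (\<lambda>n. - int n) = UNIV"
    by (auto simp: image_iff) (metis int_cases2)
  ultimately show ?thesis by simp
qed

definition Z :: real where "Z = (\<Sum>\<^sub>\<infinity>k. 1 / (w k)\<^sup>2)"

lemma sum_inverse_w_le: "finite F \<Longrightarrow> (\<Sum>k\<in>F. 1 / (w k)\<^sup>2) \<le> Z"
  unfolding Z_def by (intro finite_sum_le_infsum summable_inverse_w) auto

lemma Z_nonneg: "Z \<ge> 0"
  using sum_inverse_w_le[of "{}"] by simp

text \<open>The larger of the two frequencies controls the sum: \<open>1 + (a + b)\<^sup>2\<close>
  is at most 4 times the larger of \<open>1 + a\<^sup>2\<close> and \<open>1 + b\<^sup>2\<close>. A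
  sum on the right replaces the maximum so that summation over \<open>l\<close> splits.\<close>

lemma w_convolution_le: "(w k)\<^sup>2 \<le> 4 powr r * ((w l)\<^sup>2 + (w (k - l))\<^sup>2)"
proof -
  define a b where "a = real_of_int l" and "b = real_of_int (k - l)"
  have k: "real_of_int k = a + b" by (simp add: a_def b_def)
  define m where "m = max (1 + a\<^sup>2) (1 + b\<^sup>2)"
  have "(a + b)\<^sup>2 \<le> 2 * a\<^sup>2 + 2 * b\<^sup>2"
    using zero_le_power2[of "a - b"] by (simp add: power2_eq_square algebra_simps)
  moreover have "1 + a\<^sup>2 \<le> m" "1 + b\<^sup>2 \<le> m" by (auto simp: m_def)
  ultimately have "1 + (a + b)\<^sup>2 \<le> 4 * m" by linarith
  then have "(w k)\<^sup>2 \<le> (4 * m) powr r"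
    unfolding w_power2 k using r by (auto intro!: powr_mono2)
  also have "\<dots> = 4 powr r * m powr r" by (rule powr_mult)
  also have "m powr r \<le> (1 + a\<^sup>2) powr r + (1 + b\<^sup>2) powr r" by (auto simp: m_def max_def)
  finally show ?thesis unfolding w_power2 a_def b_def by simp
qed

section \<open>The algebra property: convolution as a bounded bilinear map\<close>

definition kernel :: "int \<Rightarrow> int \<Rightarrow> real" where
  "kernel k l = w k / (w (k - l) * w l)"

definition KB :: real where "KB = sqrt (2 * 4 powr r * Z)"

lemma KB_nonneg: "KB \<ge> 0"
  by (simp add: KB_def Z_nonneg)

lemma abs_kernel [simp]: "\<bar>kernel k l\<bar> = kernel k l"
  by (simp add: kernel_def abs_mult less_imp_le)

text \<open>The rows of the kernel are bounded in \<open>l^2\<close>, uniformly in \<open>k\<close>.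
  In weighted coordinates convolution has exactly this kernel, with one weight from the output and
  two inverse weights from the inputs. Each of the two sums of inverse weights is at most
  \<open>Z\<close>, which explains the factor 2 in \<open>KB\<close>.\<close>

lemma sum_kernel_le:
  assumes "finite F"
  shows "(\<Sum>l\<in>F. (kernel k l)\<^sup>2) \<le> KB\<^sup>2"
proof -
  have "(\<Sum>l\<in>F. (kernel k l)\<^sup>2) \<le> (\<Sum>l\<in>F. 4 powr r * (1 / (w (k - l))\<^sup>2 + 1 / (w l)\<^sup>2))"
  proof (rule sum_mono)
    fix l
    have "(kernel k l)\<^sup>2 = (w k)\<^sup>2 / ((w (k - l))\<^sup>2 * (w l)\<^sup>2)"
      by (simp add: kernel_def power_divide power_mult_distrib)
    also have "\<dots> \<le> 4 powr r * ((w l)\<^sup>2 + (w (k - l))\<^sup>2) / ((w (k - l))\<^sup>2 * (w l)\<^sup>2)"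
      by (intro divide_right_mono w_convolution_le) auto
    also have "\<dots> = 4 powr r * (1 / (w (k - l))\<^sup>2 + 1 / (w l)\<^sup>2)" by (simp add: field_simps)
    finally show "(kernel k l)\<^sup>2 \<le> 4 powr r * (1 / (w (k - l))\<^sup>2 + 1 / (w l)\<^sup>2)" .
  qed
  also have "\<dots> = 4 powr r * ((\<Sum>l\<in>F. 1 / (w (k - l))\<^sup>2) + (\<Sum>l\<in>F. 1 / (w l)\<^sup>2))"
    unfolding sum_distrib_left[symmetric] sum.distrib by (rule refl)
  also have "(\<Sum>l\<in>F. 1 / (w (k - l))\<^sup>2) = (\<Sum>j\<in>(\<lambda>l. k - l) ` F. 1 / (w j)\<^sup>2)"
    by (subst sum.reindex) (auto simp: inj_on_def)
  also have "4 powr r * (\<dots> + (\<Sum>l\<in>F. 1 / (w l)\<^sup>2)) \<le> 4 powr r * (Z + Z)"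
    using assms by (intro mult_left_mono add_mono sum_inverse_w_le) auto
  also have "\<dots> = KB\<^sup>2" by (simp add: KB_def Z_nonneg)
  finally show ?thesis .
qed

definition conv_term :: "int ell2 \<Rightarrow> int ell2 \<Rightarrow> int \<Rightarrow> int \<Rightarrow> complex" where
  "conv_term x y k l = of_real (kernel k l) * (coord x (k - l) * coord y l)"

text \<open>Convolution of the unweighted sequences, in weighted coordinates.\<close>

definition B :: "int ell2 \<Rightarrow> int ell2 \<Rightarrow> int ell2" where
  "B x y = Abs_ell2 (\<lambda>k. \<Sum>\<^sub>\<infinity>l. conv_term x y k l)"

lemma sum_conv_term_power2:
  assumes F: "finite F"
  shows "(\<Sum>l\<in>F. cmod (conv_term x y k l))\<^sup>2
    \<le> KB\<^sup>2 * (\<Sum>l\<in>F. (cmod (coord x (k - l)))\<^sup>2 * (cmod (coord y l))\<^sup>2)"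
proof -
  have "(\<Sum>l\<in>F. cmod (conv_term x y k l))\<^sup>2
      = (\<Sum>l\<in>F. kernel k l * (cmod (coord x (k - l)) * cmod (coord y l)))\<^sup>2"
    unfolding conv_term_def norm_mult norm_of_real abs_kernel by (rule refl)
  also have "\<dots> \<le> (\<Sum>l\<in>F. (kernel k l)\<^sup>2) * (\<Sum>l\<in>F. (cmod (coord x (k - l)) * cmod (coord y l))\<^sup>2)"
    by (rule Cauchy_Schwarz_ineq_sum)
  also have "\<dots> \<le> KB\<^sup>2 * (\<Sum>l\<in>F. (cmod (coord x (k - l)) * cmod (coord y l))\<^sup>2)"
    by (intro mult_right_mono sum_kernel_le F sum_nonneg) auto
  finally show ?thesis by (simp add: power_mult_distrib)
qed

lemma sum_conv_term_le:
  assumes F: "finite F"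
  shows "(\<Sum>l\<in>F. cmod (conv_term x y k l)) \<le> KB * norm x * norm y"
proof (rule power2_le_imp_le)
  have "(\<Sum>l\<in>F. (cmod (coord x (k - l)))\<^sup>2 * (cmod (coord y l))\<^sup>2) \<le> (\<Sum>l\<in>F. (norm x)\<^sup>2 * (cmod (coord y l))\<^sup>2)"
    by (intro sum_mono mult_right_mono power_mono norm_coord_le) auto
  also have "\<dots> \<le> (norm x)\<^sup>2 * (norm y)\<^sup>2"
    unfolding sum_distrib_left[symmetric] by (intro mult_left_mono sum_coord_le_norm F) auto
  finally have "KB\<^sup>2 * (\<Sum>l\<in>F. (cmod (coord x (k - l)))\<^sup>2 * (cmod (coord y l))\<^sup>2)
      \<le> KB\<^sup>2 * ((norm x)\<^sup>2 * (norm y)\<^sup>2)" by (intro mult_left_mono) auto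
  then show "(\<Sum>l\<in>F. cmod (conv_term x y k l))\<^sup>2 \<le> (KB * norm x * norm y)\<^sup>2"
    using order_trans[OF sum_conv_term_power2[OF F]] by (simp add: power_mult_distrib mult.assoc)
qed (simp add: KB_nonneg)

lemmas summable_conv_term = summable_on_bounded_sums(1)[OF sum_conv_term_le]

text \<open>After Cauchy-Schwarz in \<open>l\<close>, what remains in \<open>k\<close> is the
  convolution of the two summable sequences of squares, whose total mass is the product of the
  masses. The sum over \<open>l\<close> is kept finite until the last limit, so that the sums can be
  exchanged.\<close>

lemma L2_set_conv_le:
  assumes G: "finite G"
  shows "L2_set (\<lambda>k. cmod (\<Sum>\<^sub>\<infinity>l. conv_term x y k l)) G \<le> KB * norm x * norm y"
proof (rule tendsto_upperbound)
  show "((\<lambda>F. L2_set (\<lambda>k. cmod (\<Sum>l\<in>F. conv_term x y k l)) G)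
      \<longlongrightarrow> L2_set (\<lambda>k. cmod (\<Sum>\<^sub>\<infinity>l. conv_term x y k l)) G) (finite_subsets_at_top UNIV)"
    unfolding L2_set_def
    by (intro tendsto_intros has_sum_infsum[OF summable_conv_term, unfolded has_sum_def])
  have "L2_set (\<lambda>k. cmod (\<Sum>l\<in>F. conv_term x y k l)) G \<le> KB * norm x * norm y" if F: "finite F" for F
  proof -
    have "(\<Sum>k\<in>G. (cmod (\<Sum>l\<in>F. conv_term x y k l))\<^sup>2)
        \<le> (\<Sum>k\<in>G. KB\<^sup>2 * (\<Sum>l\<in>F. (cmod (coord x (k - l)))\<^sup>2 * (cmod (coord y l))\<^sup>2))"
    proof (rule sum_mono)
      fix k
      have "(cmod (\<Sum>l\<in>F. conv_term x y k l))\<^sup>2 \<le> (\<Sum>l\<in>F. cmod (conv_term x y k l))\<^sup>2"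
        by (intro power_mono norm_sum) auto
      then show "(cmod (\<Sum>l\<in>F. conv_term x y k l))\<^sup>2
          \<le> KB\<^sup>2 * (\<Sum>l\<in>F. (cmod (coord x (k - l)))\<^sup>2 * (cmod (coord y l))\<^sup>2)"
        using sum_conv_term_power2[OF F] by (rule order_trans)
    qed
    also have "\<dots> = KB\<^sup>2 * (\<Sum>l\<in>F. (\<Sum>k\<in>G. (cmod (coord x (k - l)))\<^sup>2) * (cmod (coord y l))\<^sup>2)"
      unfolding sum_distrib_left[symmetric] sum_distrib_right by (subst sum.swap) simp
    also have "\<dots> \<le> KB\<^sup>2 * (\<Sum>l\<in>F. (norm x)\<^sup>2 * (cmod (coord y l))\<^sup>2)"
    proof (intro mult_left_mono sum_mono mult_right_mono)
      fix l
      have "(\<Sum>k\<in>G. (cmod (coord x (k - l)))\<^sup>2) = (\<Sum>j\<in>(\<lambda>k. k - l) ` G. (cmod (coord x j))\<^sup>2)"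
        by (subst sum.reindex) (auto simp: inj_on_def)
      also have "\<dots> \<le> (norm x)\<^sup>2" using G by (intro sum_coord_le_norm) auto
      finally show "(\<Sum>k\<in>G. (cmod (coord x (k - l)))\<^sup>2) \<le> (norm x)\<^sup>2" .
    qed auto
    also have "\<dots> \<le> KB\<^sup>2 * ((norm x)\<^sup>2 * (norm y)\<^sup>2)"
      unfolding sum_distrib_left[symmetric] by (intro mult_left_mono sum_coord_le_norm F) auto
    finally have "(\<Sum>k\<in>G. (cmod (\<Sum>l\<in>F. conv_term x y k l))\<^sup>2) \<le> (KB * norm x * norm y)\<^sup>2"
      by (simp add: power_mult_distrib mult.assoc)
    then show ?thesis unfolding L2_set_def by (rule real_le_lsqrt[rotated]) (simp add: KB_nonneg)
  qed
  then show "\<forall>\<^sub>F F in finite_subsets_at_top UNIV.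
      L2_set (\<lambda>k. cmod (\<Sum>l\<in>F. conv_term x y k l)) G \<le> KB * norm x * norm y"
    by (intro eventually_finite_subsets_at_top_weakI)
qed simp

lemma coord_B: "coord (B x y) k = (\<Sum>\<^sub>\<infinity>l. conv_term x y k l)"
  unfolding B_def by (subst coord_Abs_ell2[OF L2_set_conv_le]) auto

lemma norm_B: "norm (B x y) \<le> KB * norm x * norm y"
  by (rule norm_ell2_le) (simp add: coord_B L2_set_conv_le)

lemma bounded_bilinear_B: "bounded_bilinear B"
proof
  fix x x' y y' :: "int ell2" and c :: real
  show "B (x + x') y = B x y + B x' y"
    by (rule ell2_eqI) (simp add: coord_B infsum_add[symmetric] summable_conv_term,
        simp add: conv_term_def algebra_simps)
  show "B x (y + y') = B x y + B x y'"
    by (rule ell2_eqI) (simp add: coord_B infsum_add[symmetric] summable_conv_term,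
        simp add: conv_term_def algebra_simps)
  show "B (c *\<^sub>R x) y = c *\<^sub>R B x y"
    by (rule ell2_eqI) (simp add: coord_B infsum_cmult_right'[symmetric],
        simp add: conv_term_def algebra_simps)
  show "B x (c *\<^sub>R y) = c *\<^sub>R B x y"
    by (rule ell2_eqI) (simp add: coord_B infsum_cmult_right'[symmetric],
        simp add: conv_term_def algebra_simps)
  show "\<exists>K. \<forall>x y. norm (B x y) \<le> norm x * norm y * K"
    using norm_B by (intro exI[of _ KB]) (auto simp: mult_ac)
qed

lemma B_single:
  "B (single a c) (single b d) = single (a + b) (of_real (w (a + b) / (w a * w b)) * (c * d))"
proof (rule ell2_eqI)
  fix k
  have "coord (B (single a c) (single b d)) k = conv_term (single a c) (single b d) k b"
    unfolding coord_B by (rule infsum_eq_single) (auto simp: conv_term_def)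
  then show "coord (B (single a c) (single b d)) k
      = coord (single (a + b) (of_real (w (a + b) / (w a * w b)) * (c * d))) k"
    by (auto simp: conv_term_def kernel_def)
qed

section \<open>The free flow in coordinates\<close>

definition S :: "real \<Rightarrow> int ell2 \<Rightarrow> int ell2" where
  "S t = diag (\<lambda>k. cis (- (t * (of_int k)\<^sup>2)))"

lemma coord_S [simp]: "coord (S t x) k = cis (- (t * (of_int k)\<^sup>2)) * coord x k"
  unfolding S_def by (rule coord_diag[of _ 1]) simp

lemma norm_S [simp]: "norm (S t x) = norm x"
  by (simp add: norm_ell2_def norm_mult)

lemma bounded_linear_S: "bounded_linear (S t)"
  unfolding S_def by (rule bounded_linear_diag[of _ 1]) simp

lemma S_S [simp]: "S s (S t x) = S (s + t) x"
  by (rule ell2_eqI) (simp add: cis_mult mult.assoc[symmetric] distrib_right)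

lemma S_0 [simp]: "S 0 x = x"
  by (rule ell2_eqI) simp

lemma S_single: "S t (single k c) = single k (cis (- (t * (of_int k)\<^sup>2)) * c)"
  by (rule ell2_eqI) simp

lemma continuous_on_S [continuous_intros]:
  fixes g :: "'s::metric_space \<Rightarrow> real"
  assumes "continuous_on A g" "continuous_on A u"
  shows "continuous_on A (\<lambda>s. S (g s) (u s))"
proof (rule continuous_on_bounded_linear_family[of "\<lambda>s. S (g s)" 1])
  show "continuous_on A (\<lambda>s. S (g s) (single k c))" for k c
    unfolding S_single
    by (intro bounded_linear.continuous_on[OF bounded_linear_single] continuous_intros assms)
qed (auto intro: bounded_linear_S assms)

section \<open>Fourier synthesis and weighted Fourier coefficients\<close>

definition E :: "int ell2 \<Rightarrow> real \<Rightarrow> complex" where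
  "E x t = (\<Sum>\<^sub>\<infinity>k. coord x k / w k * cis (of_int k * t))"

text \<open>The embedding of \<open>H^r\<close> into bounded functions: Cauchy-Schwarz against the
  square summable inverse weights makes the series absolutely convergent at every point.\<close>

lemma sum_E_le:
  assumes F: "finite F"
  shows "(\<Sum>k\<in>F. cmod (coord x k / w k * cis (of_int k * t))) \<le> sqrt Z * norm x"
proof -
  have "(\<Sum>k\<in>F. cmod (coord x k / w k * cis (of_int k * t))) = (\<Sum>k\<in>F. \<bar>1 / w k\<bar> * \<bar>cmod (coord x k)\<bar>)"
    by (simp add: norm_mult norm_divide less_imp_le)
  also have "\<dots> \<le> L2_set (\<lambda>k. 1 / w k) F * L2_set (\<lambda>k. cmod (coord x k)) F"
    by (rule L2_set_mult_ineq)
  also have "\<dots> \<le> sqrt Z * norm x"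
    using sum_inverse_w_le[OF F] Z_nonneg
    by (intro mult_mono L2_set_coord_le_norm F) (auto simp: L2_set_def power_divide intro!: sum_nonneg)
  finally show ?thesis .
qed

lemmas summable_E = summable_on_bounded_sums(1)[OF sum_E_le]

lemma norm_E_le: "cmod (E x t) \<le> sqrt Z * norm x"
  unfolding E_def by (rule summable_on_bounded_sums(2)[OF sum_E_le])

lemma bounded_linear_E: "bounded_linear (\<lambda>x. E x t)"
proof (rule bounded_linear_intro[of _ "sqrt Z"])
  show "E (x + y) t = E x t + E y t" for x y
    using infsum_add[OF summable_E[of x t] summable_E[of y t]]
    unfolding E_def coord_simps add_divide_distrib distrib_right .
  show "E (c *\<^sub>R x) t = c *\<^sub>R E x t" for c x
    unfolding E_def scaleR_conv_of_real infsum_cmult_right'[symmetric] by (simp add: mult.assoc)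
  show "norm (E x t) \<le> norm x * sqrt Z" for x
    using norm_E_le by (simp add: mult.commute)
qed

lemmas E_add = linear_add[OF bounded_linear.linear[OF bounded_linear_E]]
lemmas E_diff = linear_diff[OF bounded_linear.linear[OF bounded_linear_E]]

lemma E_single: "E (single k c) t = c / w k * cis (of_int k * t)"
  unfolding E_def by (subst infsum_eq_single[of k]) auto

lemma continuous_on_E: "continuous_on A (E x)"
  by (rule continuous_on_bounded_linear_family[of "\<lambda>t x. E x t" "sqrt Z" A "\<lambda>_. x"])
    (auto intro!: bounded_linear_E norm_E_le continuous_intros simp: E_single)

text \<open>The convolution theorem. Both sides are separately bounded linear, so testing two modes
  replaces the rearrangement of a double series.\<close>

lemma E_mult: "E x t * E y t = E (B x y) t"
proof (rule separately_linear_eq_on_single[of "\<lambda>x y. E x t * E y t" "\<lambda>x y. E (B x y) t"])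
  show "bounded_linear (\<lambda>y. E x t * E y t)" "bounded_linear (\<lambda>y. E y t * E x t)" for x
    by (intro bounded_linear_const_mult bounded_linear_mult_const bounded_linear_E)+
  show "bounded_linear (\<lambda>y. E (B x y) t)" "bounded_linear (\<lambda>y. E (B y x) t)" for x
    by (intro bounded_linear_compose[OF bounded_linear_E] bounded_bilinear_B
        bounded_bilinear.bounded_linear_left bounded_bilinear.bounded_linear_right)+
  show "E (single k c) t * E (single l d) t = E (B (single k c) (single l d)) t" for k l c d
    by (simp add: B_single E_single cis_mult[symmetric] distrib_right field_simps)
qed

lemma measurable_E [measurable]: "E x \<in> borel_measurable torus"
  by (intro borel_measurable_torus_continuous continuous_on_E)

lemma integrable_E: "integrable torus (E x)"
  by (rule integrable_torus_bounded[OF measurable_E norm_E_le])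

text \<open>Orthogonality for single modes, extended by density; the extension needs continuity of
  the coefficient in \<open>x\<close>, which the uniform bound \<open>norm_E_le\<close>
  supplies.\<close>

lemma fourier_coeff_E [simp]: "fourier_coeff (E x) k = coord x k / w k"
proof (rule bounded_linear_eq_on_single[of "\<lambda>x. fourier_coeff (E x) k" "\<lambda>x. coord x k / w k"])
  show "bounded_linear (\<lambda>x. fourier_coeff (E x) k)"
  proof (rule bounded_linear_intro)
    show "fourier_coeff (E (x + y)) k = fourier_coeff (E x) k + fourier_coeff (E y) k" for x y
      using fourier_coeff_add[OF integrable_E integrable_E] E_add by (metis (no_types, lifting) ext)
    show "fourier_coeff (E (c *\<^sub>R x)) k = c *\<^sub>R fourier_coeff (E x) k" for c x
      by (simp add: scaleR_conv_of_real mult.assoc fourier_coeff_def linear_scale[OF bounded_linear.linear[OF bounded_linear_E]])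
    show "norm (fourier_coeff (E x) k) \<le> norm x * sqrt Z" for x
    proof -
      have "norm (LINT t|torus. E x t * cis (- (of_int k * t))) \<le> (LINT t|torus. sqrt Z * norm x)"
        using integrable_torus_cis[OF integrable_E, of x "- of_int k"] norm_E_le[of x]
          finite_measure.integrable_const[OF finite_measure_torus]
        by (intro Bochner_Integration.integral_norm_bound_integral) (auto simp: norm_mult)
      also have "\<dots> = 2 * pi * (sqrt Z * norm x)"
        by (simp add: measure_restrict_space)
      finally show ?thesis by (simp add: fourier_coeff_def norm_divide field_simps)
    qed
  qed
  show "bounded_linear (\<lambda>x. coord x k / complex_of_real (w k))"
    by (intro bounded_linear_compose[OF bounded_linear_divide] bounded_linear_coord)
  show "fourier_coeff (E (single j c)) k = coord (single j c) k / w k" for j c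
    unfolding E_single[abs_def] using fourier_coeff_cis[of "c / w j" j k] by auto
qed

text \<open>Weighted Fourier coefficients; \<open>E\<close> above is the inverse up to null sets.\<close>

definition J :: "(real \<Rightarrow> complex) \<Rightarrow> int ell2" where
  "J f = Abs_ell2 (\<lambda>k. w k * fourier_coeff f k)"

lemma sobolev_norm_integrand: "(cmod (w k * fourier_coeff f k))\<^sup>2
    = (1 + (of_int k)\<^sup>2) powr r * (cmod (fourier_coeff f k))\<^sup>2"
  by (simp add: norm_mult power_mult_distrib w_power2)

lemma coord_J:
  assumes "f \<in> sobolev r"
  shows "coord (J f) k = w k * fourier_coeff f k"
proof -
  have "(\<lambda>k. (cmod (w k * fourier_coeff f k))\<^sup>2) summable_on UNIV"
    using assms unfolding sobolev_norm_integrand by (simp add: sobolev_def)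
  then show ?thesis unfolding J_def by (simp add: Abs_ell2_inverse)
qed

lemma norm_J: "f \<in> sobolev r \<Longrightarrow> norm (J f) = sobolev_norm r f"
  unfolding norm_ell2_def sobolev_norm_def sobolev_norm_integrand[symmetric] by (simp add: coord_J)

lemma J_eqI: "(\<And>k. fourier_coeff f k = coord x k / w k) \<Longrightarrow> J f = x"
  by (simp add: J_def coord_inverse)

text \<open>The common criterion behind sums, squares and changes of representative: an almost
  everywhere identity with some \<open>E x\<close> gives membership and the coordinates at once.
  Square integrability holds since \<open>E x\<close> is bounded on a set of finite measure.\<close>

lemma sobolev_AE_E:
  assumes f: "f \<in> borel_measurable torus" "AE t in torus. f t = E x t"
  shows "f \<in> sobolev r" "J f = x"
proof -
  have fc: "fourier_coeff f k = coord x k / w k" for k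
    using fourier_coeff_cong_AE[OF f(2,1) measurable_E] by simp
  then show "J f = x" by (rule J_eqI)
  have "integrable torus (\<lambda>t. (cmod (f t))\<^sup>2)"
  proof (rule finite_measure.integrable_const_bound[OF finite_measure_torus, of _ "(sqrt Z * norm x)\<^sup>2"])
    show "AE t in torus. norm ((cmod (f t))\<^sup>2) \<le> (sqrt Z * norm x)\<^sup>2"
      using f(2)
    proof eventually_elim
      case (elim t)
      have "(cmod (E x t))\<^sup>2 \<le> (sqrt Z * norm x)\<^sup>2" by (intro power_mono norm_E_le) auto
      then show ?case by (simp add: elim)
    qed
    show "(\<lambda>t. (cmod (f t))\<^sup>2) \<in> borel_measurable torus" using f(1) by measurable
  qed
  moreover have "(\<lambda>k. (1 + (of_int k)\<^sup>2) powr r * (cmod (fourier_coeff f k))\<^sup>2) summable_on UNIV"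
    using square_summable_coord[of x] unfolding sobolev_norm_integrand[symmetric] by (simp add: fc)
  ultimately show "f \<in> sobolev r" using f(1) by (simp add: sobolev_def)
qed

lemma sobolev_E [simp]: "E x \<in> sobolev r" "J (E x) = x"
  by (auto intro: sobolev_AE_E)

lemma integrable_sobolev: "f \<in> sobolev r \<Longrightarrow> integrable torus f"
proof -
  assume f: "f \<in> sobolev r"
  then have "f \<in> borel_measurable torus" by (simp add: sobolev_def)
  then have "(\<lambda>x. (f x)\<^sup>2) \<in> borel_measurable torus" by measurable
  moreover have "integrable torus (\<lambda>x. (cmod (f x))\<^sup>2)" using f by (simp add: sobolev_def)
  ultimately have "integrable torus (\<lambda>x. (f x)\<^sup>2)"
    by (subst integrable_norm_iff[symmetric]) (auto simp: norm_power)
  with \<open>f \<in> borel_measurable torus\<close> show ?thesis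
    by (rule finite_measure.square_integrable_imp_integrable[OF finite_measure_torus])
qed

text \<open>The difference has vanishing Fourier coefficients, so their uniqueness applies; from
  here on functions and sequences are interchangeable up to null sets.\<close>

lemma AE_E_J:
  assumes f: "f \<in> sobolev r"
  shows "AE t in torus. f t = E (J f) t"
proof -
  have "AE t in torus. f t - E (J f) t = 0"
    by (rule fourier_coeff_zero_AE)
      (simp_all add: fourier_coeff_diff integrable_sobolev[OF f] integrable_E coord_J[OF f])
  then show ?thesis by eventually_elim simp
qed

end

text \<open>Completeness of Lebesgue measure is essential. \<open>nls_solution\<close> ties the
  initial value to \<open>u 0\<close> only almost everywhere, so its measurability has to be
  inherited from \<open>u 0\<close>.\<close>

lemma borel_measurable_torus_cong_AE:
  fixes f g :: "real \<Rightarrow> complex"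
  assumes f: "f \<in> borel_measurable torus" and eq: "AE x in torus. f x = g x"
  shows "g \<in> borel_measurable torus"
proof -
  have null: "A \<in> sets torus" if "A \<subseteq> B" "B \<in> null_sets torus" for A B
  proof -
    have B: "B \<in> null_sets lebesgue" "B \<subseteq> {0<..<2 * pi}"
      using that(2) by (auto simp: null_sets_restrict_space)
    then have "A \<in> sets lebesgue"
      using null_setsD2[OF null_sets_completion_subset[OF that(1) B(1)]] by simp
    then show ?thesis using B that(1) by (auto simp: sets_restrict_space_iff)
  qed
  interpret complete_measure torus by standard (rule null)
  show ?thesis
  proof (rule measurableI)
    fix U :: "complex set" assume U: "U \<in> sets borel"
    have "AE x in torus. x \<in> f -` U \<inter> space torus \<longleftrightarrow> x \<in> g -` U \<inter> space torus"
      using eq by eventually_elim simp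
    then show "g -` U \<inter> space torus \<in> sets torus"
      by (rule in_sets_AE) (use measurable_sets[OF f U] in auto)
  qed simp
qed

context sobolev_space
begin

lemma sobolev_cong_AE:
  assumes "f \<in> sobolev r" "AE x in torus. f x = g x"
  shows "g \<in> sobolev r" "J g = J f"
proof -
  have "g \<in> borel_measurable torus"
    using assms by (intro borel_measurable_torus_cong_AE[of f g]) (auto simp: sobolev_def)
  moreover have "AE x in torus. g x = E (J f) x"
    using AE_E_J[OF assms(1)] assms(2) by eventually_elim simp
  ultimately show "g \<in> sobolev r" "J g = J f" by (rule sobolev_AE_E)+
qed

lemma sobolev_diff:
  assumes "f \<in> sobolev r" "g \<in> sobolev r"
  shows "(\<lambda>x. f x - g x) \<in> sobolev r" "J (\<lambda>x. f x - g x) = J f - J g"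
proof -
  have "AE x in torus. f x - g x = E (J f - J g) x"
    using AE_E_J[OF assms(1)] AE_E_J[OF assms(2)] by eventually_elim (simp add: E_diff)
  moreover have "(\<lambda>x. f x - g x) \<in> borel_measurable torus" using assms by (auto simp: sobolev_def)
  ultimately show "(\<lambda>x. f x - g x) \<in> sobolev r" "J (\<lambda>x. f x - g x) = J f - J g"
    by (auto intro: sobolev_AE_E)
qed

lemma sobolev_add:
  assumes "f \<in> sobolev r" "g \<in> sobolev r"
  shows "(\<lambda>x. f x + g x) \<in> sobolev r" "J (\<lambda>x. f x + g x) = J f + J g"
proof -
  have "AE x in torus. f x + g x = E (J f + J g) x"
    using AE_E_J[OF assms(1)] AE_E_J[OF assms(2)] by eventually_elim (simp add: E_add)
  moreover have "(\<lambda>x. f x + g x) \<in> borel_measurable torus" using assms by (auto simp: sobolev_def)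
  ultimately show "(\<lambda>x. f x + g x) \<in> sobolev r" "J (\<lambda>x. f x + g x) = J f + J g"
    by (auto intro: sobolev_AE_E)
qed

lemma sobolev_square:
  assumes "f \<in> sobolev r"
  shows "(\<lambda>x. (f x)\<^sup>2) \<in> sobolev r" "J (\<lambda>x. (f x)\<^sup>2) = B (J f) (J f)"
proof -
  have "AE x in torus. (f x)\<^sup>2 = E (B (J f) (J f)) x"
    using AE_E_J[OF assms] by eventually_elim (simp add: E_mult[symmetric] power2_eq_square)
  moreover have "(\<lambda>x. (f x)\<^sup>2) \<in> borel_measurable torus" using assms by (auto simp: sobolev_def)
  ultimately show "(\<lambda>x. (f x)\<^sup>2) \<in> sobolev r" "J (\<lambda>x. (f x)\<^sup>2) = B (J f) (J f)"
    by (auto intro: sobolev_AE_E)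
qed

definition mul :: "complex \<Rightarrow> int ell2 \<Rightarrow> int ell2" where
  "mul c = diag (\<lambda>_. c)"

lemma coord_mul [simp]: "coord (mul c x) k = c * coord x k"
  unfolding mul_def by (rule coord_diag[of _ "cmod c"]) simp

lemma bounded_linear_mul: "bounded_linear (mul c)"
  unfolding mul_def by (rule bounded_linear_diag[of _ "cmod c"]) simp

lemma norm_mul_le: "norm (mul c x) \<le> cmod c * norm x"
  unfolding mul_def by (rule norm_diag_le) simp

end

section \<open>The quadratic Schroedinger equation\<close>

text \<open>
  The equation in the interaction picture \<open>y t = S (- t) (J (u t))\<close> becomes the
  ordinary differential equation \<open>y' = N t y y\<close> with a bounded right-hand side.
\<close>

locale quadratic_nls = sobolev_space +
  fixes \<mu> :: complex
begin

definition N :: "real \<Rightarrow> int ell2 \<Rightarrow> int ell2 \<Rightarrow> int ell2" where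
  "N s x y = S (- s) (mul (- \<i> * \<mu>) (B (S s x) (S s y)))"

text \<open>The summand 1 keeps the constant positive when \<open>\<mu> = 0\<close>.\<close>

definition K :: real where "K = cmod \<mu> * KB + 1"

sublocale quadratic_ode N K
proof (rule quadratic_ode.intro)
  show "bounded_bilinear (N t)" for t
  proof -
    have "bounded_bilinear (\<lambda>x y. B (S t x) (S t y))"
      by (rule bounded_bilinear.comp[OF bounded_bilinear_B bounded_linear_S bounded_linear_S])
    then have "bounded_bilinear (\<lambda>x y. mul (- \<i> * \<mu>) (B (S t x) (S t y)))"
      by (rule bounded_bilinear_linear_compose[OF bounded_linear_mul])
    then show ?thesis
      unfolding N_def by (rule bounded_bilinear_linear_compose[OF bounded_linear_S])
  qed
  show "norm (N t x y) \<le> K * norm x * norm y" for t x y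
  proof -
    have "norm (N t x y) \<le> cmod \<mu> * norm (B (S t x) (S t y))"
      using norm_mul_le[of "- \<i> * \<mu>"] by (simp add: N_def norm_mult)
    also have "\<dots> \<le> cmod \<mu> * (KB * norm x * norm y)"
      using norm_B[of "S t x" "S t y"] by (intro mult_left_mono) auto
    also have "\<dots> \<le> cmod \<mu> * (KB * norm x * norm y) + norm x * norm y" by simp
    also have "\<dots> = K * norm x * norm y" by (simp add: K_def algebra_simps)
    finally show ?thesis .
  qed
  show "K > 0" using KB_nonneg by (simp add: K_def add_nonneg_pos)
  show "continuous_on A (\<lambda>s. N s (u s) (v s))" if "continuous_on A u" "continuous_on A v" for A u v
    unfolding N_def
    by (intro continuous_intros bounded_linear.continuous_on[OF bounded_linear_mul]
        bounded_bilinear.continuous_on[OF bounded_bilinear_B] that)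
qed

lemma S_N: "S t (N t x y) = mul (- \<i> * \<mu>) (B (S t x) (S t y))"
  by (simp add: N_def)

text \<open>The factor \<open>cis ((of_int k)\<^sup>2 * t)\<close> is an integrating factor that
  cancels the linear term in each coefficient. The equation is given for single coefficients and
  inside the open interval, so it is integrated coordinate by coordinate, continuity covers the
  endpoints, and the coordinates are reassembled because they commute with the integral.\<close>

lemma nls_solution_imp_mild:
  assumes u: "nls_solution r \<mu> \<tau> v u" and "0 \<le> \<tau>"
  shows "mild \<tau> (J v) (\<lambda>t. S (- t) (J (u t)))" "v \<in> sobolev r"
proof -
  have us: "u t \<in> sobolev r" if "t \<in> {0..\<tau>}" for t using u that by (simp add: nls_solution_def)
  have "AE x in torus. u 0 x = v x" using u by (simp add: nls_solution_def)
  then have v: "v \<in> sobolev r" "J v = J (u 0)"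
    using sobolev_cong_AE[of "u 0" v] us[of 0] \<open>0 \<le> \<tau>\<close> by auto
  show "v \<in> sobolev r" by fact
  define y where "y t = S (- t) (J (u t))" for t
  have "continuous_on {0..\<tau>} (\<lambda>t. J (u t))"
    unfolding continuous_on_def
  proof
    fix t assume t: "t \<in> {0..\<tau>}"
    have "((\<lambda>s. sobolev_norm r (\<lambda>x. u s x - u t x)) \<longlongrightarrow> 0) (at t within {0..\<tau>})"
      using u t by (simp add: nls_solution_def)
    moreover have "\<forall>\<^sub>F s in at t within {0..\<tau>}. norm (J (u s) - J (u t)) = sobolev_norm r (\<lambda>x. u s x - u t x)"
      unfolding eventually_at_filter
      using t by (intro always_eventually) (auto simp: norm_J[symmetric] sobolev_diff us)
    ultimately have "((\<lambda>s. norm (J (u s) - J (u t))) \<longlongrightarrow> 0) (at t within {0..\<tau>})"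
      by (simp add: tendsto_cong)
    then show "((\<lambda>s. J (u s)) \<longlongrightarrow> J (u t)) (at t within {0..\<tau>})"
      unfolding tendsto_dist_iff[of _ "J (u t)"] dist_norm .
  qed
  then have cy: "continuous_on {0..\<tau>} y" unfolding y_def by (intro continuous_intros)
  have cN: "continuous_on {0..t} (\<lambda>s. N s (y s) (y s))" if "t \<in> {0..\<tau>}" for t
    using cy that by (rule continuous_N_subset)
  have deriv: "((\<lambda>s. coord (y s) k) has_vector_derivative coord (N t (y t) (y t)) k) (at t)"
    if t: "t \<in> {0<..<\<tau>}" for t k
  proof -
    obtain D where D: "((\<lambda>s. fourier_coeff (u s) k) has_vector_derivative D) (at t)"
      "\<i> * D = (of_int k)\<^sup>2 * fourier_coeff (u t) k + \<mu> * fourier_coeff (\<lambda>x. (u t x)\<^sup>2) k"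
      using u t unfolding nls_solution_def by blast
    have ut: "u t \<in> sobolev r" using us t by simp
    have "w k * fourier_coeff (\<lambda>x. (u t x)\<^sup>2) k = coord (B (J (u t)) (J (u t))) k"
      using coord_J[OF sobolev_square(1)[OF ut], of k] sobolev_square(2)[OF ut] by simp
    then have "coord (N t (y t) (y t)) k
        = cis ((of_int k)\<^sup>2 * t) * (- \<i> * \<mu> * (w k * fourier_coeff (\<lambda>x. (u t x)\<^sup>2) k))"
      by (simp add: N_def y_def mult.commute)
    also have "\<dots> = w k * cis ((of_int k)\<^sup>2 * t) * (D + \<i> * (of_int k)\<^sup>2 * fourier_coeff (u t) k)"
    proof -
      have "D + \<i> * (of_int k)\<^sup>2 * fourier_coeff (u t) k
          = - \<i> * (\<i> * D - (of_int k)\<^sup>2 * fourier_coeff (u t) k)"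
        by (simp add: algebra_simps)
      also have "\<dots> = - \<i> * \<mu> * fourier_coeff (\<lambda>x. (u t x)\<^sup>2) k" unfolding D(2) by simp
      finally show ?thesis by simp
    qed
    finally have eq: "coord (N t (y t) (y t)) k
        = w k * (cis ((of_int k)\<^sup>2 * t) * D + \<i> * (of_int k)\<^sup>2 * cis ((of_int k)\<^sup>2 * t) * fourier_coeff (u t) k)"
      by (simp add: algebra_simps)
    have "((\<lambda>s. w k * (cis ((of_int k)\<^sup>2 * s) * fourier_coeff (u s) k)) has_vector_derivative
        coord (N t (y t) (y t)) k) (at t)"
      unfolding eq by (intro has_vector_derivative_mult_right has_vector_derivative_mult has_vector_derivative_cis[of "(of_int k)\<^sup>2", simplified] D)
    then show ?thesis
    \<comment> \<open>The two curves are known to agree only where \<open>u s\<close> lies in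
      \<open>sobolev r\<close>, so the derivative is transferred on an open neighbourhood of
      \<open>t\<close>.\<close>
    proof (rule has_vector_derivative_transform_within_open[of _ _ _ "{0<..<\<tau>}"])
      fix s assume "s \<in> {0<..<\<tau>}"
      then have "u s \<in> sobolev r" using us by simp
      then show "w k * (cis ((of_int k)\<^sup>2 * s) * fourier_coeff (u s) k) = coord (y s) k"
        by (simp add: y_def mult.commute coord_J)
    qed (use t in auto)
  qed
  have "y t = J v + integral {0..t} (\<lambda>s. N s (y s) (y s))" if t: "t \<in> {0..\<tau>}" for t
  proof (rule ell2_eqI)
    fix k
    have "((\<lambda>s. coord (N s (y s) (y s)) k) has_integral coord (y t) k - coord (y 0) k) {0..t}"
    proof (rule fundamental_theorem_of_calculus_interior)
      show "continuous_on {0..t} (\<lambda>s. coord (y s) k)"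
        using t by (intro continuous_intros continuous_on_subset[OF cy]) auto
    qed (use t deriv in auto)
    moreover have "integral {0..t} (\<lambda>s. coord (N s (y s) (y s)) k) = coord (integral {0..t} (\<lambda>s. N s (y s) (y s))) k"
      using integral_linear[OF integrable_continuous_interval[OF cN[OF t]] bounded_linear_coord, of k]
      by (simp add: o_def)
    ultimately show "coord (y t) k = coord (J v + integral {0..t} (\<lambda>s. N s (y s) (y s))) k"
      by (simp add: v y_def[of 0] integral_unique diff_eq_eq add.commute)
  qed
  with cy show "mild \<tau> (J v) (\<lambda>t. S (- t) (J (u t)))" by (simp add: mild_def y_def)
qed

text \<open>The integrand is continuous in norm, so \<open>y\<close> is differentiable as a curve in
  \<open>l^2\<close> and the coefficient equations follow by taking coordinates. The second space
  derivative enters only through the derivative of the phase.\<close>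

lemma mild_imp_nls_solution:
  assumes y: "mild \<tau> (J v) y" and v: "v \<in> sobolev r" and "0 \<le> \<tau>"
  shows "nls_solution r \<mu> \<tau> v (\<lambda>t. E (S t (y t)))"
  unfolding nls_solution_def
proof (intro conjI ballI allI)
  have cy: "continuous_on {0..\<tau>} y" using y by (simp add: mild_def)
  show "E (S t (y t)) \<in> sobolev r" for t by simp
  show "AE x in torus. E (S 0 (y 0)) x = v x"
    using AE_E_J[OF v] y \<open>0 \<le> \<tau>\<close> by (auto simp: mild_def elim: eventually_mono)
  show "((\<lambda>s. sobolev_norm r (\<lambda>x. E (S s (y s)) x - E (S t (y t)) x)) \<longlongrightarrow> 0) (at t within {0..\<tau>})"
    if t: "t \<in> {0..\<tau>}" for t
  proof -
    have "continuous_on {0..\<tau>} (\<lambda>t. S t (y t))" by (intro continuous_intros cy)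
    then have "((\<lambda>s. S s (y s)) \<longlongrightarrow> S t (y t)) (at t within {0..\<tau>})"
      using t by (simp add: continuous_on_def)
    then have "((\<lambda>s. norm (S s (y s) - S t (y t))) \<longlongrightarrow> 0) (at t within {0..\<tau>})"
      unfolding tendsto_dist_iff[of _ "S t (y t)"] dist_norm .
    then show ?thesis by (simp add: norm_J[symmetric] sobolev_diff)
  qed
  fix t k assume t: "t \<in> {0<..<\<tau>}"
  let ?F = "\<lambda>s. N s (y s) (y s)"
  have "((\<lambda>t. J v + integral {0..t} ?F) has_vector_derivative 0 + ?F t) (at t within {0..\<tau>})"
    using t integral_has_vector_derivative[of 0 \<tau> ?F t] continuous_N[OF cy cy]
    by (intro has_vector_derivative_add has_vector_derivative_const) auto
  then have "(y has_vector_derivative ?F t) (at t within {0..\<tau>})"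
    using t y
    by (intro has_vector_derivative_transform[of t "{0..\<tau>}" y "\<lambda>t. J v + integral {0..t} ?F"])
      (auto simp: mild_def)
  then have "(y has_vector_derivative ?F t) (at t)"
    using t by (simp add: at_within_Icc_at)
  then have yd: "((\<lambda>s. coord (y s) k) has_vector_derivative coord (?F t) k) (at t)"
    by (rule bounded_linear.has_vector_derivative[OF bounded_linear_coord])
  let ?c = "- (of_int k)\<^sup>2 :: real"
  let ?D = "(cis (?c * t) * coord (?F t) k + \<i> * of_real ?c * cis (?c * t) * coord (y t) k) / w k"
  have "((\<lambda>s. cis (?c * s) * coord (y s) k / w k) has_vector_derivative ?D) (at t)"
    by (intro has_vector_derivative_divide has_vector_derivative_mult has_vector_derivative_cis yd)
  moreover have "(\<lambda>s. cis (?c * s) * coord (y s) k / w k) = (\<lambda>s. fourier_coeff (E (S s (y s))) k)"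
    by (simp add: mult.commute fun_eq_iff)
  ultimately have "((\<lambda>s. fourier_coeff (E (S s (y s))) k) has_vector_derivative ?D) (at t)"
    by (simp only:)
  moreover have "\<i> * ?D = (of_int k)\<^sup>2 * fourier_coeff (E (S t (y t))) k
      + \<mu> * fourier_coeff (\<lambda>x. (E (S t (y t)) x)\<^sup>2) k"
  proof -
    have "cis (?c * t) * coord (?F t) k = coord (S t (?F t)) k" by (simp add: mult.commute)
    also have "\<dots> = - \<i> * \<mu> * coord (B (S t (y t)) (S t (y t))) k" unfolding S_N by simp
    finally have *: "\<i> * (cis (?c * t) * coord (?F t) k) = \<mu> * coord (B (S t (y t)) (S t (y t))) k"
      by (simp add: mult.assoc[symmetric])
    have "\<i> * ?D = (\<i> * (cis (?c * t) * coord (?F t) k) + (of_int k)\<^sup>2 * (cis (?c * t) * coord (y t) k)) / w k"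
      by (simp add: algebra_simps)
    also have "\<dots> = (of_int k)\<^sup>2 * fourier_coeff (E (S t (y t))) k
      + \<mu> * (coord (B (S t (y t)) (S t (y t))) k / w k)"
      unfolding * by (simp add: add_divide_distrib mult.commute)
    also have "coord (B (S t (y t)) (S t (y t))) k / w k = fourier_coeff (\<lambda>x. (E (S t (y t)) x)\<^sup>2) k"
      by (simp add: power2_eq_square E_mult)
    finally show ?thesis .
  qed
  ultimately show "\<exists>D. ((\<lambda>s. fourier_coeff (E (S s (y s))) k) has_vector_derivative D) (at t) \<and>
      \<i> * D = (of_int k)\<^sup>2 * fourier_coeff (E (S t (y t))) k
        + \<mu> * fourier_coeff (\<lambda>x. (E (S t (y t)) x)\<^sup>2) k"
    by (intro exI[of _ ?D] conjI)
qed

text \<open>The choice in \<open>fine_propagator\<close> is harmless: a solution exists, and by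
  \<open>mild_unique\<close> every solution has the same coordinates at time \<open>\<tau>\<close>.
  The function itself is fixed only up to a null set, hence the formulation through
  \<open>J\<close>.\<close>

lemma fine_propagator_mild:
  assumes y: "mild \<tau> (J v) y" and v: "v \<in> sobolev r" and "0 \<le> \<tau>"
  shows "fine_propagator r \<mu> \<tau> v \<in> sobolev r" "J (fine_propagator r \<mu> \<tau> v) = S \<tau> (y \<tau>)"
proof -
  have ex: "\<exists>w u. nls_solution r \<mu> \<tau> v u \<and> w = u \<tau>"
    using mild_imp_nls_solution[OF assms] by (intro exI conjI) (assumption, rule refl)
  have "\<exists>u. nls_solution r \<mu> \<tau> v u \<and> fine_propagator r \<mu> \<tau> v = u \<tau>"
    using someI_ex[OF ex] unfolding fine_propagator_def .
  then obtain u where u: "nls_solution r \<mu> \<tau> v u" "fine_propagator r \<mu> \<tau> v = u \<tau>" by blast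
  show "fine_propagator r \<mu> \<tau> v \<in> sobolev r"
    using u \<open>0 \<le> \<tau>\<close> by (simp add: nls_solution_def)
  have "y \<tau> = S (- \<tau>) (J (u \<tau>))"
    using mild_unique[OF y nls_solution_imp_mild(1)[OF u(1) \<open>0 \<le> \<tau>\<close>], of \<tau>] \<open>0 \<le> \<tau>\<close> by simp
  then show "J (fine_propagator r \<mu> \<tau> v) = S \<tau> (y \<tau>)" by (simp add: u(2))
qed

end

section \<open>Convergence of the parareal iteration\<close>

text \<open>
  One parareal iteration gains a factor \<open>\<tau>\<close>: the local defect of the coarse map has Lipschitz
  constant \<open>b * \<tau>\<^sup>2\<close> and is accumulated over at most \<open>T / \<tau>\<close> steps.
\<close>

lemma parareal_iteration_error:
  fixes \<Gamma> \<Phi> :: "'a::real_normed_vector \<Rightarrow> 'a" and x z e :: "nat \<Rightarrow> 'a"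
  assumes \<Gamma>: "\<And>p q. norm p \<le> R \<Longrightarrow> norm q \<le> R \<Longrightarrow> norm (\<Gamma> p - \<Gamma> q) \<le> (1 + a * \<tau>) * norm (p - q)"
    and defect: "\<And>p q. norm p \<le> R \<Longrightarrow> norm q \<le> R \<Longrightarrow>
      norm ((\<Phi> p - \<Gamma> p) - (\<Phi> q - \<Gamma> q)) \<le> b * \<tau>\<^sup>2 * norm (p - q)"
    and pos: "a \<ge> 0" "b \<ge> 0" "\<tau> > 0" "\<epsilon> \<ge> 0"
    and T: "real n\<^sub>c * \<tau> = T"
    and x: "\<And>n. n \<le> n\<^sub>c \<Longrightarrow> norm (x n) \<le> R" "\<And>n. n \<le> n\<^sub>c \<Longrightarrow> norm (x n - e n) \<le> \<epsilon>"
    and e: "\<And>n. n \<le> n\<^sub>c \<Longrightarrow> norm (e n) \<le> R - 1" "\<And>n. n < n\<^sub>c \<Longrightarrow> e (Suc n) = \<Phi> (e n)"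
    and z: "z 0 = e 0" "\<And>n. n < n\<^sub>c \<Longrightarrow> z (Suc n) = \<Gamma> (z n) + (\<Phi> (x n) - \<Gamma> (x n))"
    and small: "T * b * exp (a * T) * \<tau> * \<epsilon> \<le> 1"
    and n: "n \<le> n\<^sub>c"
  shows "norm (z n - e n) \<le> T * b * exp (a * T) * \<tau> * \<epsilon>"
proof -
  have "0 \<le> T" using T pos by auto
  \<comment> \<open>A crude summation: at most \<open>T / \<tau>\<close> defects of size
    \<open>b * \<tau>\<^sup>2 * \<epsilon>\<close>, each amplified by at most
    \<open>exp (a * T)\<close>; one power of \<open>\<tau>\<close> survives.\<close>
  have crude: "real n * (b * \<tau>\<^sup>2 * \<epsilon>) * (1 + a * \<tau>) ^ n \<le> T * b * exp (a * T) * \<tau> * \<epsilon>"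
    if n: "n \<le> n\<^sub>c" for n
  proof -
    have "real n * \<tau> \<le> real n\<^sub>c * \<tau>" using n pos by (intro mult_right_mono) auto
    then have n\<tau>: "real n * \<tau> \<le> T" using T by simp
    have "(1 + a * \<tau>) ^ n \<le> exp (a * \<tau>) ^ n"
      using pos by (intro power_mono exp_ge_add_one_self) auto
    also have "\<dots> = exp (a * (real n * \<tau>))" by (simp add: exp_of_nat_mult[symmetric] mult_ac)
    also have "\<dots> \<le> exp (a * T)" using n\<tau> pos by (simp add: mult_left_mono)
    finally have "(real n * \<tau>) * (b * \<tau> * \<epsilon>) * (1 + a * \<tau>) ^ n \<le> T * (b * \<tau> * \<epsilon>) * exp (a * T)"
      using n\<tau> pos \<open>0 \<le> T\<close> by (intro mult_mono) auto
    then show ?thesis by (simp add: power2_eq_square mult_ac)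
  qed
  have "norm (z n - e n) \<le> real n * (b * \<tau>\<^sup>2 * \<epsilon>) * (1 + a * \<tau>) ^ n" if "n \<le> n\<^sub>c" for n
    using that
  proof (induction n)
    case 0
    then show ?case by (simp add: z)
  next
    case (Suc n)
    let ?q = "b * \<tau>\<^sup>2 * \<epsilon>"
    have n: "n \<le> n\<^sub>c" "n < n\<^sub>c" using Suc.prems by auto
    have IH: "norm (z n - e n) \<le> real n * ?q * (1 + a * \<tau>) ^ n" by (rule Suc.IH[OF n(1)])
    \<comment> \<open>\<open>\<Gamma>\<close> is Lipschitz on the ball only. The error bound already
      available for \<open>n\<close> is at most 1 and keeps \<open>z n\<close> in the ball, because
      \<open>norm (e n) \<le> R - 1\<close>.\<close>
    also have "\<dots> \<le> 1" using crude[OF n(1)] small by simp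
    finally have "norm (z n) \<le> R" using e(1)[OF n(1)] norm_triangle_sub[of "z n" "e n"] by simp
    moreover have eR: "norm (e n) \<le> R" using e(1)[OF n(1)] by simp
    ultimately have "norm (\<Gamma> (z n) - \<Gamma> (e n)) \<le> (1 + a * \<tau>) * norm (z n - e n)" by (rule \<Gamma>)
    also have "\<dots> \<le> (1 + a * \<tau>) * (real n * ?q * (1 + a * \<tau>) ^ n)"
      using pos by (intro mult_left_mono IH) auto
    finally have 1: "norm (\<Gamma> (z n) - \<Gamma> (e n)) \<le> real n * ?q * (1 + a * \<tau>) ^ Suc n"
      by (simp add: mult_ac)
    have "norm ((\<Phi> (x n) - \<Gamma> (x n)) - (\<Phi> (e n) - \<Gamma> (e n))) \<le> b * \<tau>\<^sup>2 * norm (x n - e n)"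
      by (rule defect[OF x(1)[OF n(1)] eR])
    also have "\<dots> \<le> ?q * 1" using x(2)[OF n(1)] pos by (simp add: mult_left_mono)
    also have "\<dots> \<le> ?q * (1 + a * \<tau>) ^ Suc n"
      using pos by (intro mult_left_mono one_le_power) auto
    finally have 2: "norm ((\<Phi> (x n) - \<Gamma> (x n)) - (\<Phi> (e n) - \<Gamma> (e n))) \<le> ?q * (1 + a * \<tau>) ^ Suc n" .
    \<comment> \<open>Adding and subtracting \<open>\<Gamma> (e n)\<close> separates the propagated
      error from the change of the defect.\<close>
    have "z (Suc n) - e (Suc n)
        = (\<Gamma> (z n) - \<Gamma> (e n)) + ((\<Phi> (x n) - \<Gamma> (x n)) - (\<Phi> (e n) - \<Gamma> (e n)))"
      using e(2)[OF n(2)] z(2)[OF n(2)] by simp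
    also have "norm \<dots> \<le> real n * ?q * (1 + a * \<tau>) ^ Suc n + ?q * (1 + a * \<tau>) ^ Suc n"
      by (intro norm_triangle_mono 1 2)
    also have "\<dots> = real (Suc n) * ?q * (1 + a * \<tau>) ^ Suc n"
      unfolding of_nat_Suc by (simp add: distrib_right)
    finally show ?case .
  qed
  with crude n show ?thesis by (meson order_trans)
qed

section \<open>Identification of the coarse propagator with the first Picard iterate\<close>

context sobolev_space
begin

lemma mul_single [simp]: "mul c (single k d) = single k (c * d)"
  by (rule ell2_eqI) simp

lemma S_single_0 [simp]: "S t (single 0 c) = single 0 c"
  by (rule ell2_eqI) simp

lemma S_mul: "S t (mul c x) = mul c (S t x)"
  by (rule ell2_eqI) simp

lemmas S_add = linear_add[OF bounded_linear.linear[OF bounded_linear_S]]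
lemmas S_diff = linear_diff[OF bounded_linear.linear[OF bounded_linear_S]]

definition invd :: "int ell2 \<Rightarrow> int ell2" where
  "invd = diag (\<lambda>k. if k = 0 then 0 else inverse (\<i> * of_int k))"

lemma norm_inverse_int_le: "cmod (if k = 0 then 0 else inverse (\<i> * of_int k)) \<le> 1" for k :: int
  by (auto simp: norm_mult norm_inverse intro!: inverse_le_1_iff[THEN iffD2])

lemma coord_invd [simp]: "coord (invd x) k = (if k = 0 then 0 else inverse (\<i> * of_int k)) * coord x k"
  unfolding invd_def by (rule coord_diag[OF norm_inverse_int_le])

lemma bounded_linear_invd: "bounded_linear invd"
  unfolding invd_def by (rule bounded_linear_diag[OF norm_inverse_int_le])

lemma invd_single: "invd (single k c) = single k ((if k = 0 then 0 else inverse (\<i> * of_int k)) * c)"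
  by (rule ell2_eqI) simp

lemma E_mul: "E (mul c x) t = c * E x t"
  unfolding E_def infsum_cmult_right'[symmetric] by (simp add: mult.assoc)

text \<open>Both sides are the same pointwise series, so this is an equality of functions and not
  only almost everywhere. It lets the nested multipliers of the coarse propagator be evaluated by
  rewriting.\<close>

lemma fourier_multiplier_sobolev:
  assumes f: "f \<in> sobolev r" and m: "\<And>k. cmod (m k) \<le> c"
  shows "fourier_multiplier m f = E (diag m (J f))"
  unfolding fourier_multiplier_def[abs_def] E_def[abs_def]
  by (simp add: coord_diag[OF m] coord_J[OF f])

lemma free_flow_sobolev: "f \<in> sobolev r \<Longrightarrow> free_flow t f = E (S t (J f))"
  unfolding free_flow_def S_def by (rule fourier_multiplier_sobolev[of _ _ 1]) auto

lemma inv_deriv_sobolev: "f \<in> sobolev r \<Longrightarrow> inv_deriv f = E (invd (J f))"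
  unfolding inv_deriv_def invd_def by (rule fourier_multiplier_sobolev[OF _ norm_inverse_int_le])

end

context quadratic_nls
begin

text \<open>The correction terms of the coarse propagator, pulled back by
  \<open>S (- \<tau>)\<close> and polarized. A bilinear form is required because the identity with
  the integral is checked on pairs of different modes.\<close>

definition duhamel1 :: "real \<Rightarrow> int ell2 \<Rightarrow> int ell2 \<Rightarrow> int ell2" where
  "duhamel1 \<tau> x y =
     mul (- \<i> * \<mu> * \<tau> * coord y 0) x + mul (- \<i> * \<mu> * \<tau> * coord x 0) y
     + single 0 (\<i> * \<mu> * \<tau> * (coord x 0 * coord y 0))
     + mul (\<mu> / 2) (S (- \<tau>) (B (S \<tau> (invd x)) (S \<tau> (invd y))) - B (invd x) (invd y))"

lemma bounded_linear_mul_left: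
  assumes "bounded_linear f"
  shows "bounded_linear (\<lambda>x. mul (f x) y)"
proof -
  obtain a where a: "\<And>x. cmod (f x) \<le> norm x * a" using bounded_linear.bounded[OF assms] by blast
  show ?thesis
  proof (rule bounded_linear_intro[of _ "a * norm y"])
    show "norm (mul (f x) y) \<le> norm x * (a * norm y)" for x
      using order_trans[OF norm_mul_le mult_right_mono[OF a norm_ge_zero]] by (simp add: mult.assoc)
  qed (auto intro!: ell2_eqI simp: linear_add[OF bounded_linear.linear[OF assms]]
      linear_scale[OF bounded_linear.linear[OF assms]] distrib_right scaleR_conv_of_real)
qed

lemmas bounded_linear_B_left = bounded_bilinear.bounded_linear_left[OF bounded_bilinear_B]
lemmas bounded_linear_B_right = bounded_bilinear.bounded_linear_right[OF bounded_bilinear_B]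

lemma bounded_linear_duhamel1:
  "bounded_linear (duhamel1 \<tau> x)" "bounded_linear (\<lambda>x. duhamel1 \<tau> x y)"
  unfolding duhamel1_def
  by (intro bounded_linear_add bounded_linear_sub bounded_linear_mul_left bounded_linear_mul
      bounded_linear_compose[OF bounded_linear_mul] bounded_linear_compose[OF bounded_linear_S]
      bounded_linear_compose[OF bounded_linear_single] bounded_linear_compose[OF bounded_linear_B_right]
      bounded_linear_compose[OF bounded_linear_B_left] bounded_linear_invd
      bounded_linear_const_mult bounded_linear_mult_const bounded_linear_coord)+

lemma continuous_on_N_const: "continuous_on A (\<lambda>s. N s x y)"
  by (intro continuous_N continuous_intros)

lemma bounded_linear_integral_N:
  assumes "0 \<le> \<tau>"
  shows "bounded_linear (\<lambda>y. integral {0..\<tau>} (\<lambda>s. N s x y))"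
    "bounded_linear (\<lambda>x. integral {0..\<tau>} (\<lambda>s. N s x y))"
proof -
  have i: "(\<lambda>s. N s x y) integrable_on {0..\<tau>}" for x y
    by (intro integrable_continuous_interval continuous_on_N_const)
  have le: "norm (integral {0..\<tau>} (\<lambda>s. N s x y)) \<le> K * norm x * norm y * \<tau>" for x y
    by (rule norm_integral_le[OF assms continuous_on_N_const norm_N])
  show "bounded_linear (\<lambda>y. integral {0..\<tau>} (\<lambda>s. N s x y))"
  proof (rule bounded_linear_intro)
    show "norm (integral {0..\<tau>} (\<lambda>s. N s x y)) \<le> norm y * (K * norm x * \<tau>)" for y
      using le[of x y] by (simp add: mult_ac)
  qed (simp_all add: bounded_bilinear.add_right[OF bilinear] bounded_bilinear.scaleR_right[OF bilinear]
      Henstock_Kurzweil_Integration.integral_add i)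
  show "bounded_linear (\<lambda>x. integral {0..\<tau>} (\<lambda>s. N s x y))"
  proof (rule bounded_linear_intro)
    show "norm (integral {0..\<tau>} (\<lambda>s. N s x y)) \<le> norm x * (K * norm y * \<tau>)" for x
      using le[of x y] by (simp add: mult_ac)
  qed (simp_all add: bounded_bilinear.add_left[OF bilinear] bounded_bilinear.scaleR_left[OF bilinear]
      Henstock_Kurzweil_Integration.integral_add i)
qed

lemma cis_resonance:
  "cis (s * (of_int (a + b))\<^sup>2) * (cis (- (s * (of_int a)\<^sup>2)) * cis (- (s * (of_int b)\<^sup>2)))
    = cis (of_int (2 * a * b) * s)"
  by (simp add: cis_mult power2_eq_square algebra_simps)

text \<open>On the modes \<open>a\<close> and \<open>b\<close> the integrand is a constant times
  \<open>cis (2 * a * b * s)\<close>. If \<open>a * b = 0\<close> the phase is constant and gives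
  \<open>\<tau>\<close>; inclusion and exclusion over \<open>a = 0\<close> and \<open>b = 0\<close>
  explains the two products with a mean and the opposite sign of the \<open>single 0\<close> term.
  Otherwise the factor \<open>1 / (2 * \<i> * a * b)\<close> is, up to a constant, a product of two
  symbols of the inverse derivative, which produces the terms with \<open>invd\<close>.\<close>

lemma duhamel1_eq_integral:
  assumes "0 \<le> \<tau>"
  shows "integral {0..\<tau>} (\<lambda>s. N s x y) = duhamel1 \<tau> x y"
proof (rule separately_linear_eq_on_single[of "\<lambda>x y. integral {0..\<tau>} (\<lambda>s. N s x y)"])
  fix a b :: int and c d :: complex
  define q where "q = complex_of_real (w (a + b) / (w a * w b)) * (c * d)"
  define I where "I = (if a * b = 0 then of_real \<tau> else (cis (of_int (2 * a * b) * \<tau>) - 1) / (\<i> * of_int (2 * a * b)))"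
  have N: "N s (single a c) (single b d) = single (a + b) (cis (of_int (2 * a * b) * s) * (- \<i> * \<mu> * q))" for s
  proof -
    have "N s (single a c) (single b d) = single (a + b) (cis (s * (of_int (a + b))\<^sup>2) *
        (cis (- (s * (of_int a)\<^sup>2)) * cis (- (s * (of_int b)\<^sup>2))) * (- \<i> * \<mu> * q))"
      unfolding N_def S_single B_single mul_single q_def by (simp add: mult_ac)
    then show ?thesis unfolding cis_resonance .
  qed
  have "((\<lambda>s. cis (of_int (2 * a * b) * s)) has_integral I) {0..\<tau>}"
  proof -
    have I: "I = (if real_of_int (2 * a * b) = 0 then of_real \<tau>
        else (cis (of_int (2 * a * b) * \<tau>) - 1) / (\<i> * of_real (of_int (2 * a * b))))"
      by (simp add: I_def)
    show ?thesis unfolding I by (rule has_integral_cis[OF assms])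
  qed
  then have "((\<lambda>s. N s (single a c) (single b d)) has_integral single (a + b) (I * (- \<i> * \<mu> * q))) {0..\<tau>}"
    unfolding N
    using has_integral_linear[OF _ bounded_linear_compose[OF bounded_linear_single bounded_linear_mult_left],
        of "\<lambda>s. cis (of_int (2 * a * b) * s)" I "{0..\<tau>}" "a + b" "- \<i> * \<mu> * q"]
    by (simp only: o_def)
  then have L: "integral {0..\<tau>} (\<lambda>s. N s (single a c) (single b d)) = single (a + b) (I * (- \<i> * \<mu> * q))"
    by (rule integral_unique)
  have "duhamel1 \<tau> (single a c) (single b d) = single (a + b) (I * (- \<i> * \<mu> * q))"
  proof (cases "a = 0 \<or> b = 0")
    \<comment> \<open>With a zero frequency the weights cancel, as \<open>w 0 = 1\<close>.\<close>
    case True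
    then show ?thesis
      by (intro ell2_eqI) (auto simp: duhamel1_def invd_single S_single B_single I_def q_def algebra_simps)
  next
    case False
    have "coord (S (- \<tau>) (B (S \<tau> (invd (single a c))) (S \<tau> (invd (single b d))))) (a + b)
       = (cis (\<tau> * (of_int (a + b))\<^sup>2) * (cis (- (\<tau> * (of_int a)\<^sup>2)) * cis (- (\<tau> * (of_int b)\<^sup>2))))
          * (inverse (\<i> * of_int a) * inverse (\<i> * of_int b) * q)"
      using False unfolding invd_single S_single B_single q_def by (simp add: mult_ac)
    then have 1: "S (- \<tau>) (B (S \<tau> (invd (single a c))) (S \<tau> (invd (single b d))))
       = single (a + b) (cis (of_int (2 * a * b) * \<tau>) * (inverse (\<i> * of_int a) * inverse (\<i> * of_int b) * q))"
      unfolding cis_resonance invd_single S_single B_single by (auto intro!: ell2_eqI)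
    have 2: "B (invd (single a c)) (invd (single b d))
       = single (a + b) (inverse (\<i> * of_int a) * inverse (\<i> * of_int b) * q)"
      using False unfolding invd_single B_single q_def by (simp add: mult_ac)
    have "\<mu> / 2 * ((cis (of_int (2 * a * b) * \<tau>) - 1) * (inverse (\<i> * of_int a) * inverse (\<i> * of_int b) * q))
        = I * (- \<i> * \<mu> * q)"
      using False by (simp add: I_def field_simps)
    then show ?thesis
      using False by (intro ell2_eqI) (auto simp: duhamel1_def 1 2 algebra_simps)
  qed
  with L show "integral {0..\<tau>} (\<lambda>s. N s (single a c) (single b d)) = duhamel1 \<tau> (single a c) (single b d)"
    by simp
qed (rule bounded_linear_integral_N[OF assms] bounded_linear_duhamel1)+

text \<open>Only the diagonal of the bilinear identity enters; there the two products with a mean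
  merge with \<open>x\<close> into the factor
  \<open>1 - 2 * \<i> * \<mu> * \<tau> * coord x 0\<close>.\<close>

lemma coarse_propagator_picard1:
  assumes v: "v \<in> sobolev r" and "0 \<le> \<tau>"
  shows "coarse_propagator \<mu> \<tau> v = E (S \<tau> (picard1 \<tau> (J v)))"
proof
  fix t
  define x where "x = J v"
  define W where "W = B (invd x) (invd x)"
  have v0: "fourier_coeff v 0 = coord x 0" by (simp add: x_def coord_J[OF v])
  have sq: "(\<lambda>y. (inv_deriv v y)\<^sup>2) = E W"
    by (simp add: inv_deriv_sobolev[OF v] power2_eq_square E_mult x_def W_def)
  have "coarse_propagator \<mu> \<tau> v t = (1 - 2 * \<i> * \<mu> * \<tau> * coord x 0) * E (S \<tau> x) t
      + \<i> * \<mu> * \<tau> * (coord x 0)\<^sup>2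
      + \<mu> / 2 * E (B (S \<tau> (invd x)) (S \<tau> (invd x))) t - \<mu> / 2 * E (S \<tau> W) t"
    unfolding coarse_propagator_def v0 sq
    by (simp add: inv_deriv_sobolev[OF v] free_flow_sobolev v x_def[symmetric] power2_eq_square E_mult)
  also have "\<dots> = E (mul (1 - 2 * \<i> * \<mu> * \<tau> * coord x 0) (S \<tau> x)
      + single 0 (\<i> * \<mu> * \<tau> * (coord x 0)\<^sup>2)
      + mul (\<mu> / 2) (B (S \<tau> (invd x)) (S \<tau> (invd x))) - mul (\<mu> / 2) (S \<tau> W)) t"
    by (simp add: E_add E_diff E_mul E_single)
  also have "mul (1 - 2 * \<i> * \<mu> * \<tau> * coord x 0) (S \<tau> x)
      + single 0 (\<i> * \<mu> * \<tau> * (coord x 0)\<^sup>2)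
      + mul (\<mu> / 2) (B (S \<tau> (invd x)) (S \<tau> (invd x))) - mul (\<mu> / 2) (S \<tau> W) = S \<tau> (x + duhamel1 \<tau> x x)"
  proof -
    have "S \<tau> (x + duhamel1 \<tau> x x) = S \<tau> x
        + (mul (- \<i> * \<mu> * \<tau> * coord x 0) (S \<tau> x) + mul (- \<i> * \<mu> * \<tau> * coord x 0) (S \<tau> x)
        + single 0 (\<i> * \<mu> * \<tau> * (coord x 0 * coord x 0))
        + mul (\<mu> / 2) (B (S \<tau> (invd x)) (S \<tau> (invd x)) - S \<tau> W))"
      by (simp add: duhamel1_def W_def S_add S_diff S_mul)
    also have "\<dots> = mul (1 - 2 * \<i> * \<mu> * \<tau> * coord x 0) (S \<tau> x)
      + single 0 (\<i> * \<mu> * \<tau> * (coord x 0)\<^sup>2)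
      + mul (\<mu> / 2) (B (S \<tau> (invd x)) (S \<tau> (invd x))) - mul (\<mu> / 2) (S \<tau> W)"
      by (rule ell2_eqI) (simp add: algebra_simps power2_eq_square del: coord_S)
    finally show ?thesis by simp
  qed
  finally show "coarse_propagator \<mu> \<tau> v t = E (S \<tau> (picard1 \<tau> (J v))) t"
    by (simp add: picard1_def duhamel1_eq_integral[OF \<open>0 \<le> \<tau>\<close>] x_def)
qed

text \<open>The equation is autonomous. Restarting at a grid point identifies the fine map with the
  advance of the given solution by one coarse step.\<close>

lemma nls_solution_shift:
  assumes u: "nls_solution r \<mu> T v u" and s: "0 \<le> s" "s + \<tau> \<le> T"
  shows "nls_solution r \<mu> \<tau> (u s) (\<lambda>t. u (s + t))"
  unfolding nls_solution_def
proof (intro conjI ballI allI)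
  have sT: "s + t \<in> {0..T}" if "t \<in> {0..\<tau>}" for t using that s by auto
  show "u (s + t) \<in> sobolev r" if "t \<in> {0..\<tau>}" for t
    using u sT[OF that] by (simp add: nls_solution_def)
  show "AE x in torus. u (s + 0) x = u s x" by simp
  show "((\<lambda>t'. sobolev_norm r (\<lambda>x. u (s + t') x - u (s + t) x)) \<longlongrightarrow> 0) (at t within {0..\<tau>})"
    if t: "t \<in> {0..\<tau>}" for t
  proof (rule filterlim_compose[of "\<lambda>t'. sobolev_norm r (\<lambda>x. u t' x - u (s + t) x)"])
    show "((\<lambda>t'. sobolev_norm r (\<lambda>x. u t' x - u (s + t) x)) \<longlongrightarrow> 0) (at (s + t) within {0..T})"
      using u sT[OF t] by (simp add: nls_solution_def)
    have "\<forall>\<^sub>F t' in at t within {0..\<tau>}. s + t' \<in> {0..T} \<and> s + t' \<noteq> s + t"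
      unfolding eventually_at_filter using sT by (intro always_eventually) auto
    moreover have "((+) s \<longlongrightarrow> s + t) (at t within {0..\<tau>})"
      by (intro tendsto_intros)
    ultimately show "filterlim ((+) s) (at (s + t) within {0..T}) (at t within {0..\<tau>})"
      by (simp add: filterlim_at)
  qed
  fix t k assume t: "t \<in> {0<..<\<tau>}"
  then have "s + t \<in> {0<..<T}" using s by auto
  then obtain D where D: "((\<lambda>s. fourier_coeff (u s) k) has_vector_derivative D) (at (s + t))"
    "\<i> * D = (of_int k)\<^sup>2 * fourier_coeff (u (s + t)) k + \<mu> * fourier_coeff (\<lambda>x. (u (s + t) x)\<^sup>2) k"
    using u unfolding nls_solution_def by blast
  have "((\<lambda>t. s + t) has_vector_derivative 1) (at t)"
    by (auto intro!: derivative_eq_intros)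
  then have "((\<lambda>t. fourier_coeff (u (s + t)) k) has_vector_derivative D) (at t)"
    using vector_diff_chain_at[of "\<lambda>t. s + t" 1 t "\<lambda>s. fourier_coeff (u s) k" D] D(1) by (simp add: o_def)
  with D(2) show "\<exists>D. ((\<lambda>t. fourier_coeff (u (s + t)) k) has_vector_derivative D) (at t) \<and>
      \<i> * D = (of_int k)\<^sup>2 * fourier_coeff (u (s + t)) k + \<mu> * fourier_coeff (\<lambda>x. (u (s + t) x)\<^sup>2) k"
    by blast
qed

section \<open>Coarse and fine maps on coordinates\<close>

definition coarse_map :: "real \<Rightarrow> int ell2 \<Rightarrow> int ell2" where
  "coarse_map \<tau> x = S \<tau> (picard1 \<tau> x)"

text \<open>Working with sequences avoids representatives: whenever a mild solution exists, its
  value at \<open>\<tau>\<close> is unique, so the choice is unambiguous.\<close>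

definition fine_map :: "real \<Rightarrow> int ell2 \<Rightarrow> int ell2" where
  "fine_map \<tau> x = S \<tau> ((SOME y. mild \<tau> x y) \<tau>)"

lemma fine_map_mild:
  assumes "mild \<tau> x y" "0 \<le> \<tau>"
  shows "fine_map \<tau> x = S \<tau> (y \<tau>)"
  using mild_unique[OF someI[of "mild \<tau> x", OF assms(1)] assms(1), of \<tau>] assms(2)
  by (simp add: fine_map_def)

text \<open>The zero state is a common fixed point, which permits starting the iteration one index
  earlier, with a correction that vanishes.\<close>

lemma fine_map_0:
  assumes "0 \<le> \<tau>"
  shows "fine_map \<tau> 0 = 0" "coarse_map \<tau> 0 = 0"
proof -
  have N0: "N s 0 0 = 0" for s using bounded_bilinear.zero_left[OF bilinear] by simp
  have S0: "S t 0 = 0" for t by (rule ell2_eqI) simp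
  have "mild \<tau> 0 (\<lambda>_. 0)" by (simp add: mild_def N0)
  from fine_map_mild[OF this assms] show "fine_map \<tau> 0 = 0" by (simp add: S0)
  show "coarse_map \<tau> 0 = 0" by (simp add: coarse_map_def picard1_def N0 S0)
qed

lemma norm_S_diff: "norm (S t x - S t y) = norm (x - y)"
  by (simp flip: S_diff)

lemma coarse_map_lipschitz:
  assumes "norm x \<le> R" "norm y \<le> R" "0 \<le> \<tau>"
  shows "norm (coarse_map \<tau> x - coarse_map \<tau> y) \<le> (1 + 2 * K * R * \<tau>) * norm (x - y)"
  using picard1_lipschitz[OF assms] by (simp add: coarse_map_def norm_S_diff)

text \<open>Curves starting in the ball of radius \<open>R\<close> stay in radius
  \<open>R + 1\<close>, which is the \<open>M\<close> of the defect estimate; the isometry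
  \<open>S \<tau>\<close> drops out of the differences.\<close>

lemma defect_lipschitz:
  assumes x: "norm x \<le> R" and z: "norm z \<le> R" and \<tau>: "0 \<le> \<tau>" "\<tau> \<le> 1" "4 * K * (R + 1)\<^sup>2 * \<tau> \<le> 1"
  shows "norm ((fine_map \<tau> x - coarse_map \<tau> x) - (fine_map \<tau> z - coarse_map \<tau> z))
    \<le> K\<^sup>2 * (R + 1)\<^sup>2 * (10 * exp (4 * K * (R + 1)) + 1) * \<tau>\<^sup>2 * norm (x - z)"
proof -
  obtain y where y: "mild \<tau> x y" "\<And>t. t \<in> {0..\<tau>} \<Longrightarrow> norm (y t) \<le> R + 1"
    using mild_exists[OF x \<tau>(1,3)] by blast
  obtain y' where y': "mild \<tau> z y'" "\<And>t. t \<in> {0..\<tau>} \<Longrightarrow> norm (y' t) \<le> R + 1"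
    using mild_exists[OF z \<tau>(1,3)] by blast
  have "R + 1 > 0" using x norm_ge_zero[of x] by linarith
  then show ?thesis
    using mild_minus_picard1_lipschitz[OF y(1) y'(1) \<tau>(1,2) y(2) y'(2)]
    by (simp add: fine_map_mild[OF y(1) \<tau>(1)] fine_map_mild[OF y'(1) \<tau>(1)] coarse_map_def flip: S_diff)
qed

lemma coarse_propagator_sobolev:
  assumes "v \<in> sobolev r" "0 \<le> \<tau>"
  shows "coarse_propagator \<mu> \<tau> v \<in> sobolev r" "J (coarse_propagator \<mu> \<tau> v) = coarse_map \<tau> (J v)"
  by (simp_all add: coarse_propagator_picard1[OF assms] coarse_map_def)

lemma fine_propagator_sobolev:
  assumes v: "v \<in> sobolev r" "norm (J v) \<le> R" and \<tau>: "0 \<le> \<tau>" "4 * K * (R + 1)\<^sup>2 * \<tau> \<le> 1"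
  shows "fine_propagator r \<mu> \<tau> v \<in> sobolev r" "J (fine_propagator r \<mu> \<tau> v) = fine_map \<tau> (J v)"
    "\<exists>u. nls_solution r \<mu> \<tau> v u"
proof -
  obtain y where y: "mild \<tau> (J v) y" using mild_exists[OF v(2) \<tau>] by blast
  show "fine_propagator r \<mu> \<tau> v \<in> sobolev r" "J (fine_propagator r \<mu> \<tau> v) = fine_map \<tau> (J v)"
    using fine_propagator_mild[OF y v(1) \<tau>(1)] fine_map_mild[OF y \<tau>(1)] by auto
  show "\<exists>u. nls_solution r \<mu> \<tau> v u" using mild_imp_nls_solution[OF y v(1) \<tau>(1)] by blast
qed

lemma nls_solution_bounded:
  assumes u: "nls_solution r \<mu> T v u" and "0 \<le> T"
  obtains M where "M > 0" "\<And>t. t \<in> {0..T} \<Longrightarrow> norm (J (u t)) \<le> M"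
proof -
  have "continuous_on {0..T} (\<lambda>t. S (- t) (J (u t)))"
    using nls_solution_imp_mild(1)[OF assms] by (simp add: mild_def)
  then have "bounded ((\<lambda>t. S (- t) (J (u t))) ` {0..T})"
    by (intro compact_imp_bounded compact_continuous_image compact_Icc)
  then obtain M where "M > 0" "\<forall>y\<in>(\<lambda>t. S (- t) (J (u t))) ` {0..T}. norm y \<le> M"
    unfolding bounded_pos by blast
  then show ?thesis using that by auto
qed

lemma nls_solution_fine_map:
  assumes u: "nls_solution r \<mu> T v u" and s: "0 \<le> s" "0 \<le> \<tau>" "s + \<tau> \<le> T"
  shows "fine_map \<tau> (J (u s)) = J (u (s + \<tau>))"
  using fine_map_mild[OF nls_solution_imp_mild(1)[OF nls_solution_shift[OF u s(1,3)] s(2)] s(2)] by simp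

end

section \<open>Choice of constants and induction over the iterations\<close>

context quadratic_nls
begin

lemma parareal_converges:
  assumes T: "T > 0" and u: "nls_solution r \<mu> T u0 u"
  shows "\<exists>\<tau>\<^sub>0 C\<^sub>1 C\<^sub>2. \<tau>\<^sub>0 > 0 \<and> C\<^sub>1 > 0 \<and> C\<^sub>2 > 0 \<and>
    (\<forall>(\<tau>::real) (Nc::nat) (k::nat). 0 < \<tau> \<and> \<tau> \<le> \<tau>\<^sub>0 \<and> real Nc * \<tau> = T \<longrightarrow>
      (let U = parareal (fine_propagator r \<mu> \<tau>) (coarse_propagator \<mu> \<tau>) u0 in
        (\<forall>n<Nc. \<exists>w. nls_solution r \<mu> \<tau> (U k n) w) \<and>
        (\<forall>n\<in>{1..Nc}. U k n \<in> sobolev r) \<and>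
        (MAX n\<in>{1..Nc}. sobolev_norm r (\<lambda>x. U k n x - u (real n * \<tau>) x)) \<le> C\<^sub>1 * (C\<^sub>2 * \<tau>) ^ k))"
proof -
  obtain M where M: "M > 0" "\<And>t. t \<in> {0..T} \<Longrightarrow> norm (J (u t)) \<le> M"
    using nls_solution_bounded[OF u] T by auto
  \<comment> \<open>The exact solution stays in radius \<open>M\<close> and the errors stay at most
    1, so all iterates lie in radius \<open>M + 1\<close>.\<close>
  define R where "R = M + 1"
  define b where "b = K\<^sup>2 * (R + 1)\<^sup>2 * (10 * exp (4 * K * (R + 1)) + 1)"
  define C where "C = T * b * exp (2 * K * R * T)"
  have R: "R \<ge> 1" using M by (simp add: R_def)
  have b: "b > 0" using K_pos R by (simp add: b_def add_pos_pos)
  have C: "C > 0" using T b by (simp add: C_def)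
  \<comment> \<open>The three bounds serve, in order, the defect estimate, the existence of fine
    solutions from the whole ball, and the requirement that the error bound
    \<open>C * R * \<tau>\<close> after one iteration be at most 1.\<close>
  define \<tau>\<^sub>0 where "\<tau>\<^sub>0 = min 1 (min (1 / (4 * K * (R + 1)\<^sup>2)) (1 / (C * R)))"
  have "\<tau>\<^sub>0 > 0" using K_pos R C by (simp add: \<tau>\<^sub>0_def)
  have u0: "u0 \<in> sobolev r" using nls_solution_imp_mild(2)[OF u] T by simp
  have us: "u t \<in> sobolev r" if "t \<in> {0..T}" for t using u that by (simp add: nls_solution_def)
  have Ju0: "J u0 = J (u 0)"
    using sobolev_cong_AE(2)[of "u 0" u0] us[of 0] u T by (simp add: nls_solution_def)
  have main: "(\<forall>n<Nc. \<exists>w. nls_solution r \<mu> \<tau> (U k n) w) \<and>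
      (\<forall>n\<in>{1..Nc}. U k n \<in> sobolev r) \<and>
      (MAX n\<in>{1..Nc}. sobolev_norm r (\<lambda>x. U k n x - u (real n * \<tau>) x)) \<le> R * (C * \<tau>) ^ k"
    if \<tau>: "0 < \<tau>" "\<tau> \<le> \<tau>\<^sub>0" "real Nc * \<tau> = T"
      and U: "U = parareal (fine_propagator r \<mu> \<tau>) (coarse_propagator \<mu> \<tau>) u0" for \<tau> Nc k U
  proof -
    have "\<tau> \<le> 1 / (4 * K * (R + 1)\<^sup>2)" "\<tau> \<le> 1 / (C * R)" and \<tau>1: "\<tau> \<le> 1"
      using \<tau>(2) by (auto simp: \<tau>\<^sub>0_def)
    then have \<tau>K: "4 * K * (R + 1)\<^sup>2 * \<tau> \<le> 1" and \<tau>C: "C * R * \<tau> \<le> 1"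
      using K_pos R C by (simp_all add: pos_le_divide_eq mult.commute)
    have "C * \<tau> * 1 \<le> C * \<tau> * R" using C \<tau> R by (intro mult_left_mono) auto
    then have C\<tau>: "C * \<tau> \<le> 1" using \<tau>C by (simp add: mult_ac)
    have grid: "real n * \<tau> \<in> {0..T}" if "n \<le> Nc" for n
    proof -
      have "real n * \<tau> \<le> real Nc * \<tau>" using that \<tau> by (intro mult_right_mono) auto
      then show ?thesis using \<tau> by simp
    qed
    define e where "e n = J (u (real n * \<tau>))" for n
    have e_le: "norm (e n) \<le> R - 1" if "n \<le> Nc" for n
      using M(2)[OF grid[OF that]] by (simp add: e_def R_def)
    have e_Suc: "e (Suc n) = fine_map \<tau> (e n)" if "n < Nc" for n
    proof -
      have "real n * \<tau> + \<tau> = real (Suc n) * \<tau>" by (simp add: algebra_simps)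
      moreover have "real (Suc n) * \<tau> \<le> T" using grid[of "Suc n"] that by simp
      ultimately show ?thesis
        using nls_solution_fine_map[OF u, of "real n * \<tau>" \<tau>] \<tau>(1) by (simp add: e_def)
    qed
    text \<open>The zero function serves as an iterate of index \<open>- 1\<close>: \<open>fine - coarse\<close> vanishes there.\<close>
    define V where "V k n = (case k of 0 \<Rightarrow> E 0 | Suc j \<Rightarrow> U j n)" for k n
    have V_0: "J (V 0 n) = 0" "V 0 n \<in> sobolev r" for n by (auto simp: V_def)
    have V_Suc_0: "V (Suc k) 0 = u0" for k by (simp add: V_def U)
    have step: "V (Suc k) (Suc n) \<in> sobolev r \<and> J (V (Suc k) (Suc n)) = coarse_map \<tau> (J (V (Suc k) n))
        + (fine_map \<tau> (J (V k n)) - coarse_map \<tau> (J (V k n)))"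
      if "V (Suc k) n \<in> sobolev r" "V k n \<in> sobolev r" "norm (J (V k n)) \<le> R" for k n
    proof -
      note c = coarse_propagator_sobolev[OF _ less_imp_le[OF \<tau>(1)]]
      note f = fine_propagator_sobolev[OF that(2,3) less_imp_le[OF \<tau>(1)] \<tau>K]
      show ?thesis
      proof (cases k)
        \<comment> \<open>The initial coarse sweep is a regular step, because the correction at the
          zero iterate vanishes by \<open>fine_map_0\<close>.\<close>
        case 0
        then have "V (Suc k) (Suc n) = coarse_propagator \<mu> \<tau> (V (Suc k) n)" by (simp add: V_def U)
        then show ?thesis
          using c[OF that(1)] \<tau>(1) 0 by (simp add: V_0 fine_map_0)
      next
        case (Suc j)
        then have "V (Suc k) (Suc n) = (\<lambda>x. coarse_propagator \<mu> \<tau> (V (Suc k) n) x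
            + (fine_propagator r \<mu> \<tau> (V k n) x - coarse_propagator \<mu> \<tau> (V k n) x))"
          by (simp add: V_def U)
        then show ?thesis
          using c[OF that(1)] c[OF that(2)] f(1,2) by (simp add: sobolev_add sobolev_diff)
      qed
    qed
    \<comment> \<open>Through the index shift \<open>V (Suc k)\<close> is \<open>U k\<close>, and
      the base case compares the zero function with the exact solution, whose norm is at most
      \<open>R - 1\<close>. The ball bound is carried along since the step estimate is valid in the
      ball only.\<close>
    have V: "\<forall>n\<le>Nc. V k n \<in> sobolev r \<and> norm (J (V k n)) \<le> R \<and> norm (J (V k n) - e n) \<le> R * (C * \<tau>) ^ k" for k
    proof (induction k)
      case 0
      show ?case using e_le R by (fastforce simp: V_0)
    next
      case (Suc k)
      have sob: "V (Suc k) n \<in> sobolev r" if "n \<le> Nc" for n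
        using that
      proof (induction n)
        case 0
        then show ?case by (simp add: V_Suc_0 u0)
      next
        case (Suc n)
        then show ?case using step[of k n] \<open>\<forall>n\<le>Nc. _\<close> by simp
      qed
      have pow: "(C * \<tau>) ^ k \<le> 1" using C\<tau> C \<tau> by (intro power_le_one) auto
      have small: "C * \<tau> * (R * (C * \<tau>) ^ k) \<le> 1"
      proof -
        have "C * \<tau> * (R * (C * \<tau>) ^ k) = C * R * \<tau> * (C * \<tau>) ^ k" by (simp add: mult_ac)
        also have "\<dots> \<le> 1 * 1" using \<tau>C pow C R \<tau> by (intro mult_mono) auto
        finally show ?thesis by simp
      qed
      have "norm (J (V (Suc k) n) - e n) \<le> T * b * exp (2 * K * R * T) * \<tau> * (R * (C * \<tau>) ^ k)"
        if "n \<le> Nc" for n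
      proof (rule parareal_iteration_error[where \<Gamma> = "coarse_map \<tau>" and \<Phi> = "fine_map \<tau>" and R = R
            and e = e and n\<^sub>c = Nc and x = "\<lambda>n. J (V k n)" and z = "\<lambda>n. J (V (Suc k) n)"])
        show "norm (coarse_map \<tau> p - coarse_map \<tau> q) \<le> (1 + 2 * K * R * \<tau>) * norm (p - q)"
          if "norm p \<le> R" "norm q \<le> R" for p q
          using coarse_map_lipschitz[OF that] \<tau> by simp
        show "norm (fine_map \<tau> p - coarse_map \<tau> p - (fine_map \<tau> q - coarse_map \<tau> q)) \<le> b * \<tau>\<^sup>2 * norm (p - q)"
          if "norm p \<le> R" "norm q \<le> R" for p q
          unfolding b_def by (rule defect_lipschitz) (use that \<tau> \<tau>1 \<tau>K in auto)
        show "J (V (Suc k) (Suc n)) = coarse_map \<tau> (J (V (Suc k) n))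
            + (fine_map \<tau> (J (V k n)) - coarse_map \<tau> (J (V k n)))" if "n < Nc" for n
          using step[of k n] sob Suc.IH that by simp
        show "J (V (Suc k) 0) = e 0" by (simp add: V_Suc_0 Ju0 e_def)
        show "T * b * exp (2 * K * R * T) * \<tau> * (R * (C * \<tau>) ^ k) \<le> 1"
          using small by (simp only: C_def[symmetric])
      qed (use Suc.IH K_pos R b C \<tau> e_le e_Suc that in auto)
      then have err: "norm (J (V (Suc k) n) - e n) \<le> C * \<tau> * (R * (C * \<tau>) ^ k)" if "n \<le> Nc" for n
        using that by (simp only: C_def[symmetric])
      have "norm (J (V (Suc k) n)) \<le> R" if "n \<le> Nc" for n
        using err[OF that] small e_le[OF that] norm_triangle_sub[of "J (V (Suc k) n)" "e n"] by simp
      with err sob show ?case by (simp add: mult_ac)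
    qed
    have UV: "U k n = V (Suc k) n" for n by (simp add: V_def)
    \<comment> \<open>All values at which the fine propagator is evaluated lie in the ball of radius
      \<open>R\<close>, so the uniform existence time covers them and the choice in its definition
      is never empty.\<close>
    have "\<exists>w. nls_solution r \<mu> \<tau> (U k n) w" if "n < Nc" for n
      using V[of "Suc k"] that fine_propagator_sobolev(3)[of "U k n" R \<tau>] \<tau> \<tau>K unfolding UV by simp
    moreover have "U k n \<in> sobolev r" if "n \<in> {1..Nc}" for n using V[of "Suc k"] that by (simp add: UV)
    moreover have "(MAX n\<in>{1..Nc}. sobolev_norm r (\<lambda>x. U k n x - u (real n * \<tau>) x)) \<le> R * (C * \<tau>) ^ k"
    proof -
      have "sobolev_norm r (\<lambda>x. U k n x - u (real n * \<tau>) x) \<le> R * (C * \<tau>) ^ k" if n: "n \<in> {1..Nc}" for n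
      proof -
        have Us: "U k n \<in> sobolev r" and le: "norm (J (U k n) - e n) \<le> R * (C * \<tau>) ^ Suc k"
          using V[of "Suc k"] n by (auto simp: UV)
        have "u (real n * \<tau>) \<in> sobolev r" using us[OF grid] n by simp
        then have "sobolev_norm r (\<lambda>x. U k n x - u (real n * \<tau>) x) = norm (J (U k n) - e n)"
          using Us by (simp add: norm_J[symmetric] sobolev_diff e_def)
        also note le
        \<comment> \<open>The index shift gives one power more than stated; it is given away using
          \<open>C * \<tau> \<le> 1\<close>.\<close>
        also have "R * (C * \<tau>) ^ Suc k \<le> R * (C * \<tau>) ^ k"
          using R C \<tau> C\<tau> by (intro mult_left_mono power_decreasing) auto
        finally show ?thesis .
      qed
      \<comment> \<open>The maximum is taken over a nonempty set, since
        \<open>T > 0\<close>.\<close>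
      moreover have "Nc \<noteq> 0" using \<tau>(3) T by (intro notI) simp
      ultimately show ?thesis by (subst Max_le_iff) auto
    qed
    ultimately show ?thesis by blast
  qed
  show ?thesis
    unfolding Let_def using \<open>\<tau>\<^sub>0 > 0\<close> R C main
    by (intro exI[of _ \<tau>\<^sub>0] exI[of _ R] exI[of _ C]) auto
qed

end

theorem theorem3p1:
  fixes r T :: real and \<mu> :: complex
    and u0 :: "real \<Rightarrow> complex" and u :: "real \<Rightarrow> real \<Rightarrow> complex"
  assumes "r > 1/2" and "T > 0"
    and "nls_solution r \<mu> T u0 u"
  shows "\<exists>\<tau>\<^sub>0 C\<^sub>1 C\<^sub>2. \<tau>\<^sub>0 > 0 \<and> C\<^sub>1 > 0 \<and> C\<^sub>2 > 0 \<and>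
    (\<forall>(\<tau>::real) (Nc::nat) (k::nat). 0 < \<tau> \<and> \<tau> \<le> \<tau>\<^sub>0 \<and> real Nc * \<tau> = T \<longrightarrow>
      (let U = parareal (fine_propagator r \<mu> \<tau>) (coarse_propagator \<mu> \<tau>) u0 in
        (\<forall>n<Nc. \<exists>w. nls_solution r \<mu> \<tau> (U k n) w) \<and>
        (\<forall>n\<in>{1..Nc}. U k n \<in> sobolev r) \<and>
        (MAX n\<in>{1..Nc}. sobolev_norm r (\<lambda>x. U k n x - u (real n * \<tau>) x)) \<le> C\<^sub>1 * (C\<^sub>2 * \<tau>) ^ k))"
proof -
  interpret quadratic_nls r \<mu>
    using assms(1) by unfold_locales
  show ?thesis using assms(2,3) by (rule parareal_converges)
qed

end
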